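(* Let $(H,R)$ be a triangular Hopf algebra over $\mathbb{C}$ (not necessarily finite-dimensional). Then the categorical dimension $\dim_c(V)$ of every finite-dimensional representation $V$ of $H$ is an integer.
   Context: A triangular Hopf algebra $(H,R)$ is a quasitriangular Hopf algebra with $R_{21}R=1\otimes 1$; its finite-dimensional representations form a rigid symmetric tensor category with commutativity constraint $\beta_{V,W}=P\circ R|_{V\otimes W}$, where $P$ is the flip. The categorical dimension $\dim_c(V)\in\mathrm{End}(\mathbf{1})=\mathbb{C}$ of an object $V$ in such a category is the composition $\mathbf{1}\to V\otimes V^*\xrightarrow{\beta_{V,V^*}}V^*\otimes V\to\mathbf{1}$ of the canonical structure morphisms of the dual $V^*$ with the commutativity constraint. *)

theory Defs
  imports Complex_Main "HOL-Library.Poly_Mapping"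
begin

section \<open>Complex vector spaces and algebras\<close>

class scaleC =
  fixes scaleC :: "complex \<Rightarrow> 'a \<Rightarrow> 'a" (infixr \<open>*\<^sub>C\<close> 75)

class complex_vector = scaleC + ab_group_add +
  assumes scaleC_add_right: "a *\<^sub>C (x + y) = a *\<^sub>C x + a *\<^sub>C y"
    and scaleC_add_left: "(a + b) *\<^sub>C x = a *\<^sub>C x + b *\<^sub>C x"
    and scaleC_scaleC [simp]: "a *\<^sub>C b *\<^sub>C x = (a * b) *\<^sub>C x"
    and scaleC_one [simp]: "1 *\<^sub>C x = x"

class complex_algebra_1 = complex_vector + ring_1 +
  assumes mult_scaleC_left [simp]: "a *\<^sub>C x * y = a *\<^sub>C (x * y)"
    and mult_scaleC_right [simp]: "x * a *\<^sub>C y = a *\<^sub>C (x * y)"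

global_interpretation complex_vector:
  vector_space "scaleC :: complex \<Rightarrow> 'a \<Rightarrow> 'a :: complex_vector"
  by unfold_locales (simp_all add: scaleC_add_right scaleC_add_left)

instantiation complex :: complex_algebra_1
begin

definition scaleC_complex_def [simp]: "scaleC a x = a * (x::complex)"

instance
  by standard (simp_all add: algebra_simps)

end

abbreviation clinear :: "('a::complex_vector \<Rightarrow> 'b::complex_vector) \<Rightarrow> bool"
  where "clinear \<equiv> Vector_Spaces.linear scaleC scaleC"

definition cbilinear ::
  "('a::complex_vector \<Rightarrow> 'b::complex_vector \<Rightarrow> 'c::complex_vector) \<Rightarrow> bool"
  where "cbilinear f \<longleftrightarrow> (\<forall>a. clinear (f a)) \<and> (\<forall>b. clinear (\<lambda>a. f a b))"

lemma clinear_iff: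
  "clinear f \<longleftrightarrow> (\<forall>x y. f (x + y) = f x + f y) \<and> (\<forall>c x. f (c *\<^sub>C x) = c *\<^sub>C f x)"
  unfolding Vector_Spaces.linear_iff
  by (auto simp: complex_vector.vector_space_axioms)

lemma cbilinear_iff:
  "cbilinear f \<longleftrightarrow>
     (\<forall>a a' b. f (a + a') b = f a b + f a' b) \<and> (\<forall>a b b'. f a (b + b') = f a b + f a b') \<and>
     (\<forall>c a b. f (c *\<^sub>C a) b = c *\<^sub>C f a b) \<and> (\<forall>c a b. f a (c *\<^sub>C b) = c *\<^sub>C f a b)"
  unfolding cbilinear_def clinear_iff by auto

lemma clinear_zero: "clinear f \<Longrightarrow> f 0 = 0"
  unfolding clinear_iff by (metis add_cancel_right_right)

lemma clinear_sum: "clinear f \<Longrightarrow> f (sum g A) = (\<Sum>x\<in>A. f (g x))"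
  by (induction A rule: infinite_finite_induct) (auto simp: clinear_zero clinear_iff)


section \<open>Tensor products\<close>

definition free_scale :: "complex \<Rightarrow> ('a \<Rightarrow>\<^sub>0 complex) \<Rightarrow> ('a \<Rightarrow>\<^sub>0 complex)"
  where "free_scale c = Poly_Mapping.map ((*) c)"

lemma lookup_free_scale [simp]: "Poly_Mapping.lookup (free_scale c p) k = c * Poly_Mapping.lookup p k"
  unfolding free_scale_def by transfer (auto simp: when_def)

global_interpretation free_space: vector_space "free_scale :: complex \<Rightarrow> ('a \<Rightarrow>\<^sub>0 complex) \<Rightarrow> _"
  by unfold_locales (auto intro!: poly_mapping_eqI simp: lookup_add algebra_simps)

definition tensor_relations :: "(('a::complex_vector \<times> 'b::complex_vector) \<Rightarrow>\<^sub>0 complex) set"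
  where "tensor_relations =
    {Poly_Mapping.single (a + a', b) 1 - (Poly_Mapping.single (a, b) 1 + Poly_Mapping.single (a', b) 1) | a a' b. True} \<union>
    {Poly_Mapping.single (a, b + b') 1 - (Poly_Mapping.single (a, b) 1 + Poly_Mapping.single (a, b') 1) | a b b'. True} \<union>
    {Poly_Mapping.single (c *\<^sub>C a, b) 1 - free_scale c (Poly_Mapping.single (a, b) 1) | c a b. True} \<union>
    {Poly_Mapping.single (a, c *\<^sub>C b) 1 - free_scale c (Poly_Mapping.single (a, b) 1) | c a b. True}"

definition tensor_rel ::
  "(('a::complex_vector \<times> 'b::complex_vector) \<Rightarrow>\<^sub>0 complex) \<Rightarrow> (('a \<times> 'b) \<Rightarrow>\<^sub>0 complex) \<Rightarrow> bool"
  where "tensor_rel p q \<longleftrightarrow> p - q \<in> free_space.span tensor_relations"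

lemma equivp_tensor_rel:
  "equivp (tensor_rel :: (('a::complex_vector \<times> 'b::complex_vector) \<Rightarrow>\<^sub>0 complex) \<Rightarrow> _)"
  (is "equivp ?R")
proof (rule equivpI)
  show "reflp ?R"
    by (auto simp: reflp_def tensor_rel_def free_space.span_zero)
  show "symp ?R"
  proof (rule sympI)
    fix p q :: "('a \<times> 'b) \<Rightarrow>\<^sub>0 complex"
    assume "tensor_rel p q"
    then have "p - q \<in> free_space.span tensor_relations"
      by (simp add: tensor_rel_def)
    then have "- (p - q) \<in> free_space.span tensor_relations"
      by (rule free_space.span_neg)
    then show "tensor_rel q p" by (simp add: tensor_rel_def)
  qed
  show "transp ?R"
  proof (rule transpI)
    fix p q r :: "('a \<times> 'b) \<Rightarrow>\<^sub>0 complex"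
    assume "tensor_rel p q" "tensor_rel q r"
    then have "p - q \<in> free_space.span tensor_relations" "q - r \<in> free_space.span tensor_relations"
      by (simp_all add: tensor_rel_def)
    then have "(p - q) + (q - r) \<in> free_space.span tensor_relations"
      by (rule free_space.span_add)
    then show "tensor_rel p r" by (simp add: tensor_rel_def)
  qed
qed

quotient_type (overloaded) ('a, 'b) tensor =
  "('a::complex_vector \<times> 'b::complex_vector) \<Rightarrow>\<^sub>0 complex" / tensor_rel
  by (rule equivp_tensor_rel)

instantiation tensor :: (complex_vector, complex_vector) complex_vector
begin

lift_definition zero_tensor :: "('a, 'b) tensor" is 0 .

lift_definition plus_tensor :: "('a, 'b) tensor \<Rightarrow> ('a, 'b) tensor \<Rightarrow> ('a, 'b) tensor" is "(+)"
  unfolding tensor_rel_def by (subst add_diff_add) (rule free_space.span_add)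

lift_definition uminus_tensor :: "('a, 'b) tensor \<Rightarrow> ('a, 'b) tensor" is uminus
  unfolding tensor_rel_def by (subst minus_diff_minus) (rule free_space.span_neg)

lift_definition minus_tensor :: "('a, 'b) tensor \<Rightarrow> ('a, 'b) tensor \<Rightarrow> ('a, 'b) tensor" is "(-)"
  unfolding tensor_rel_def
proof -
  fix p p' q q' :: "('a \<times> 'b) \<Rightarrow>\<^sub>0 complex"
  assume "p - p' \<in> free_space.span tensor_relations" "q - q' \<in> free_space.span tensor_relations"
  then have "(p - p') - (q - q') \<in> free_space.span tensor_relations"
    by (rule free_space.span_diff)
  moreover have "p - q - (p' - q') = (p - p') - (q - q')" by simp
  ultimately show "p - q - (p' - q') \<in> free_space.span tensor_relations" by (simp only:)
qed

lift_definition scaleC_tensor :: "complex \<Rightarrow> ('a, 'b) tensor \<Rightarrow> ('a, 'b) tensor" is free_scale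
  unfolding tensor_rel_def
  by (subst free_space.scale_right_diff_distrib[symmetric]) (rule free_space.span_scale)

instance
  by standard
    (transfer; simp add: tensor_rel_def free_space.span_zero algebra_simps
       free_space.scale_right_distrib free_space.scale_left_distrib)+

end

lift_definition pure_tensor :: "'a::complex_vector \<Rightarrow> 'b::complex_vector \<Rightarrow> ('a, 'b) tensor"
    (infixr \<open>\<otimes>\<^sub>t\<close> 76)
  is "\<lambda>a b. Poly_Mapping.single (a, b) 1" .

lemma cbilinear_pure_tensor: "cbilinear (\<otimes>\<^sub>t)"
  unfolding cbilinear_iff
  by (safe; transfer; unfold tensor_rel_def; rule free_space.span_base;
      unfold tensor_relations_def; blast)

lemmas pure_tensor_simps =
  cbilinear_pure_tensor[unfolded cbilinear_iff, THEN conjunct1, rule_format]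
  cbilinear_pure_tensor[unfolded cbilinear_iff, THEN conjunct2, THEN conjunct1, rule_format]
  cbilinear_pure_tensor[unfolded cbilinear_iff, THEN conjunct2, THEN conjunct2, THEN conjunct1, rule_format]
  cbilinear_pure_tensor[unfolded cbilinear_iff, THEN conjunct2, THEN conjunct2, THEN conjunct2, rule_format]

lemma tensor_induct [case_names zero pure add, induct type: tensor]:
  assumes zero: "P 0" and pure: "\<And>a b. P (a \<otimes>\<^sub>t b)"
    and add: "\<And>t u. P t \<Longrightarrow> P u \<Longrightarrow> P (t + u)"
  shows "P t"
proof -
  have "P (abs_tensor p)" for p :: "('a \<times> 'b) \<Rightarrow>\<^sub>0 complex"
  proof (induction "card (Poly_Mapping.keys p)" arbitrary: p rule: less_induct)
    case less
    show ?case
    proof (cases "p = 0")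
      case True
      then show ?thesis using zero by (simp add: zero_tensor_def)
    next
      case False
      then obtain k where k: "k \<in> Poly_Mapping.keys p"
        by (metis all_not_in_conv lookup_zero not_in_keys_iff_lookup_eq_zero poly_mapping_eqI)
      define q where "q = p - Poly_Mapping.single k (Poly_Mapping.lookup p k)"
      have "Poly_Mapping.keys q = Poly_Mapping.keys p - {k}"
        by (auto simp: q_def in_keys_iff lookup_minus lookup_single when_def split: if_splits)
      then have "card (Poly_Mapping.keys q) < card (Poly_Mapping.keys p)"
        using k by (metis card_Diff1_less finite_keys)
      then have Pq: "P (abs_tensor q)" by (rule less)
      obtain a b where ab: "k = (a, b)" by force
      have "abs_tensor (Poly_Mapping.single k (Poly_Mapping.lookup p k)) =
          abs_tensor (free_scale (Poly_Mapping.lookup p k) (Poly_Mapping.single (a, b) 1))"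
        by (rule arg_cong[where f = abs_tensor])
           (auto intro!: poly_mapping_eqI simp: lookup_single when_def ab)
      also have "\<dots> = Poly_Mapping.lookup p k *\<^sub>C (a \<otimes>\<^sub>t b)"
        by (simp add: scaleC_tensor.abs_eq pure_tensor.abs_eq)
      also have "\<dots> = (Poly_Mapping.lookup p k *\<^sub>C a) \<otimes>\<^sub>t b"
        by (simp add: pure_tensor_simps)
      finally have "P (abs_tensor (Poly_Mapping.single k (Poly_Mapping.lookup p k)))"
        using pure by simp
      then have "P (abs_tensor q + abs_tensor (Poly_Mapping.single k (Poly_Mapping.lookup p k)))"
        using Pq add by blast
      then show ?thesis
        by (simp add: plus_tensor.abs_eq q_def)
    qed
  qed
  then show ?thesis
    by (metis Quotient3_abs_rep[OF Quotient3_tensor])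
qed

definition free_eval ::
  "('a \<Rightarrow> 'b \<Rightarrow> 'c::complex_vector) \<Rightarrow> (('a \<times> 'b) \<Rightarrow>\<^sub>0 complex) \<Rightarrow> 'c"
  where "free_eval f p = (\<Sum>k\<in>Poly_Mapping.keys p. Poly_Mapping.lookup p k *\<^sub>C f (fst k) (snd k))"

lemma free_eval_superset:
  "finite A \<Longrightarrow> Poly_Mapping.keys p \<subseteq> A \<Longrightarrow> free_eval f p = (\<Sum>k\<in>A. Poly_Mapping.lookup p k *\<^sub>C f (fst k) (snd k))"
  unfolding free_eval_def
  by (rule sum.mono_neutral_left) (auto simp: in_keys_iff)

lemma free_eval_add: "free_eval f (p + q) = free_eval f p + free_eval f q"
proof -
  have "Poly_Mapping.keys (p + q) \<subseteq> Poly_Mapping.keys p \<union> Poly_Mapping.keys q" by (rule keys_add)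
  then show ?thesis
    by (simp add: free_eval_superset[of "Poly_Mapping.keys p \<union> Poly_Mapping.keys q"] lookup_add scaleC_add_left sum.distrib)
qed

lemma free_eval_scale: "free_eval f (free_scale c p) = c *\<^sub>C free_eval f p"
proof -
  have "Poly_Mapping.keys (free_scale c p) \<subseteq> Poly_Mapping.keys p" by (auto simp: in_keys_iff)
  then show ?thesis
    by (simp add: free_eval_superset[of "Poly_Mapping.keys p"] complex_vector.scale_sum_right)
qed

lemma free_eval_diff: "free_eval f (p - q) = free_eval f p - free_eval f q"
  using free_eval_add[of f "p - q" q] by simp

lemma free_eval_single [simp]: "free_eval f (Poly_Mapping.single (a, b) 1) = f a b"
  by (simp add: free_eval_def)

lemma free_eval_relations:
  assumes "cbilinear f" "p \<in> free_space.span tensor_relations"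
  shows "free_eval f p = 0"
  using assms(2)
proof (induction rule: free_space.span_induct_alt)
  case base
  show ?case by (simp add: free_eval_def)
next
  case (step c x y)
  then have "free_eval f x = 0"
    using assms(1) unfolding tensor_relations_def cbilinear_iff
    by (auto simp: free_eval_diff free_eval_add free_eval_scale)
  then show ?case
    by (simp add: step free_eval_add free_eval_scale)
qed

text \<open>The linear map on the tensor product induced by a bilinear map; for functions that are
  not bilinear the value depends on the chosen representative and is meaningless.\<close>

definition tensor_lift ::
  "('a::complex_vector \<Rightarrow> 'b::complex_vector \<Rightarrow> 'c::complex_vector) \<Rightarrow> ('a, 'b) tensor \<Rightarrow> 'c"
  where "tensor_lift f t = free_eval f (rep_tensor t)"

lemma tensor_lift_abs: "cbilinear f \<Longrightarrow> tensor_lift f (abs_tensor p) = free_eval f p"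
proof -
  assume f: "cbilinear f"
  have "tensor_rel (rep_tensor (abs_tensor p)) p"
    by (rule Quotient3_rep_abs[OF Quotient3_tensor]) (rule equivp_reflp[OF equivp_tensor_rel])
  then have "free_eval f (rep_tensor (abs_tensor p) - p) = 0"
    unfolding tensor_rel_def by (rule free_eval_relations[OF f])
  then show ?thesis by (simp add: tensor_lift_def free_eval_diff)
qed

lemma abs_rep_tensor: "abs_tensor (rep_tensor t) = t"
  by (rule Quotient3_abs_rep[OF Quotient3_tensor])

lemma tensor_lift_pure [simp]: "cbilinear f \<Longrightarrow> tensor_lift f (a \<otimes>\<^sub>t b) = f a b"
  by (simp add: pure_tensor.abs_eq tensor_lift_abs)

lemma tensor_lift_add: "cbilinear f \<Longrightarrow> tensor_lift f (t + u) = tensor_lift f t + tensor_lift f u"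
  using tensor_lift_abs[of f "rep_tensor t + rep_tensor u"]
  by (simp add: plus_tensor.abs_eq[symmetric] abs_rep_tensor free_eval_add tensor_lift_def)

lemma tensor_lift_scale: "cbilinear f \<Longrightarrow> tensor_lift f (c *\<^sub>C t) = c *\<^sub>C tensor_lift f t"
  using tensor_lift_abs[of f "free_scale c (rep_tensor t)"]
  by (simp add: scaleC_tensor.abs_eq[symmetric] abs_rep_tensor free_eval_scale tensor_lift_def)

lemma clinear_tensor_lift: "cbilinear f \<Longrightarrow> clinear (tensor_lift f)"
  by (simp add: clinear_iff tensor_lift_add tensor_lift_scale)

lemma tensor_lift_zero [simp]: "cbilinear f \<Longrightarrow> tensor_lift f 0 = 0"
  by (rule clinear_zero[OF clinear_tensor_lift])

lemma tensor_lift_fun_add: "tensor_lift (\<lambda>a b. f a b + g a b) t = tensor_lift f t + tensor_lift g t"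
  by (simp add: tensor_lift_def free_eval_def scaleC_add_right sum.distrib)

lemma tensor_lift_fun_scale: "tensor_lift (\<lambda>a b. c *\<^sub>C f a b) t = c *\<^sub>C tensor_lift f t"
  by (simp add: tensor_lift_def free_eval_def complex_vector.scale_sum_right mult.commute)

definition tensor_map ::
  "('a::complex_vector \<Rightarrow> 'c::complex_vector) \<Rightarrow> ('b::complex_vector \<Rightarrow> 'd::complex_vector)
    \<Rightarrow> ('a, 'b) tensor \<Rightarrow> ('c, 'd) tensor"
  where "tensor_map f g = tensor_lift (\<lambda>a b. f a \<otimes>\<^sub>t g b)"

definition tensor_flip :: "('a::complex_vector, 'b::complex_vector) tensor \<Rightarrow> ('b, 'a) tensor"
  where "tensor_flip = tensor_lift (\<lambda>a b. b \<otimes>\<^sub>t a)"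

definition tensor_assoc ::
  "(('a::complex_vector, 'b::complex_vector) tensor, 'c::complex_vector) tensor
    \<Rightarrow> ('a, ('b, 'c) tensor) tensor"
  where "tensor_assoc = tensor_lift (\<lambda>t c. tensor_lift (\<lambda>a b. a \<otimes>\<^sub>t (b \<otimes>\<^sub>t c)) t)"

lemma tensor_map_pure [simp]:
  "clinear f \<Longrightarrow> clinear g \<Longrightarrow> tensor_map f g (a \<otimes>\<^sub>t b) = f a \<otimes>\<^sub>t g b"
  unfolding tensor_map_def
  by (subst tensor_lift_pure) (auto simp: cbilinear_iff clinear_iff pure_tensor_simps)

lemma clinear_tensor_map:
  "clinear f \<Longrightarrow> clinear g \<Longrightarrow> clinear (tensor_map f g)"
  unfolding tensor_map_def
  by (rule clinear_tensor_lift) (auto simp: cbilinear_iff clinear_iff pure_tensor_simps)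

lemma tensor_flip_pure [simp]: "tensor_flip (a \<otimes>\<^sub>t b) = b \<otimes>\<^sub>t a"
  unfolding tensor_flip_def
  by (subst tensor_lift_pure) (auto simp: cbilinear_iff pure_tensor_simps)

lemma clinear_tensor_flip: "clinear tensor_flip"
  unfolding tensor_flip_def
  by (rule clinear_tensor_lift) (auto simp: cbilinear_iff pure_tensor_simps)

lemma cbilinear_tensor_assoc_aux:
  "cbilinear (\<lambda>t c. tensor_lift (\<lambda>a b. a \<otimes>\<^sub>t (b \<otimes>\<^sub>t c)) t)"
proof -
  have "cbilinear (\<lambda>a b. a \<otimes>\<^sub>t (b \<otimes>\<^sub>t c))" for c
    by (auto simp: cbilinear_iff pure_tensor_simps)
  then show ?thesis
    by (auto simp: cbilinear_iff tensor_lift_add tensor_lift_scale pure_tensor_simps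
        tensor_lift_fun_add tensor_lift_fun_scale)
qed

lemma tensor_assoc_pure [simp]: "tensor_assoc ((a \<otimes>\<^sub>t b) \<otimes>\<^sub>t c) = a \<otimes>\<^sub>t (b \<otimes>\<^sub>t c)"
  unfolding tensor_assoc_def
  by (simp add: cbilinear_tensor_assoc_aux)
     (subst tensor_lift_pure, auto simp: cbilinear_iff pure_tensor_simps)

lemma clinear_tensor_assoc: "clinear tensor_assoc"
  unfolding tensor_assoc_def
  by (rule clinear_tensor_lift[OF cbilinear_tensor_assoc_aux])


section \<open>The tensor product of algebras\<close>

lemma exists_functional_one: "\<exists>\<phi> :: 'a::complex_algebra_1 \<Rightarrow> complex. clinear \<phi> \<and> \<phi> 1 = 1"
proof -
  let ?B = "complex_vector.extend_basis {1::'a}"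
  have ind: "\<not> complex_vector.dependent {1::'a}" by simp
  note B = complex_vector.independent_extend_basis[OF ind] complex_vector.span_extend_basis[OF ind]
    complex_vector.extend_basis_superset[OF ind]
  let ?\<phi> = "\<lambda>v. complex_vector.representation ?B v 1"
  have "clinear ?\<phi>"
    by (simp add: clinear_iff complex_vector.representation_add[OF B(1)]
        complex_vector.representation_scale[OF B(1)] B(2))
  moreover have "?\<phi> 1 = 1"
    using complex_vector.representation_basis[OF B(1), of 1] B(3) by auto
  ultimately show ?thesis by blast
qed

instantiation tensor :: (complex_algebra_1, complex_algebra_1) complex_algebra_1
begin

definition one_tensor :: "('a, 'b) tensor" where "one_tensor = 1 \<otimes>\<^sub>t 1"

definition times_tensor :: "('a, 'b) tensor \<Rightarrow> ('a, 'b) tensor \<Rightarrow> ('a, 'b) tensor"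
  where "times_tensor t u = tensor_lift (\<lambda>a b. tensor_lift (\<lambda>c d. (a * c) \<otimes>\<^sub>t (b * d)) u) t"

lemma tensor_times_inner: "cbilinear (\<lambda>c d. (a * c) \<otimes>\<^sub>t (b * d))"
  for a :: 'a and b :: 'b
  by (auto simp: cbilinear_iff pure_tensor_simps algebra_simps)

lemma tensor_times_outer:
  "cbilinear (\<lambda>a b. tensor_lift (\<lambda>c d. (a * c) \<otimes>\<^sub>t (b * d)) u)"
  for u :: "('a, 'b) tensor"
  by (auto simp: cbilinear_iff pure_tensor_simps distrib_right tensor_lift_fun_add tensor_lift_fun_scale)

lemma tensor_times_pure: "(a \<otimes>\<^sub>t b) * (c \<otimes>\<^sub>t d) = (a * c) \<otimes>\<^sub>t (b * d)"
  for a c :: 'a and b d :: 'b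
  unfolding times_tensor_def
  by (subst tensor_lift_pure[OF tensor_times_outer]) (rule tensor_lift_pure[OF tensor_times_inner])

lemma tensor_times_bilinear: "cbilinear ((*) :: ('a, 'b) tensor \<Rightarrow> _)"
  unfolding cbilinear_iff times_tensor_def
  by (simp add: tensor_times_outer tensor_times_inner tensor_lift_add tensor_lift_scale tensor_lift_fun_add tensor_lift_fun_scale)

lemma tensor_times_simps:
  fixes t u v :: "('a, 'b) tensor"
  shows "(t + u) * v = t * v + u * v" "v * (t + u) = v * t + v * u"
    "(c *\<^sub>C t) * u = c *\<^sub>C (t * u)" "t * (c *\<^sub>C u) = c *\<^sub>C (t * u)"
  using tensor_times_bilinear unfolding cbilinear_iff by blast+

lemma tensor_times_zero: "(0 :: ('a, 'b) tensor) * t = 0" "t * 0 = 0"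
  by (metis add_cancel_right_right tensor_times_simps(1)) (metis add_cancel_right_right tensor_times_simps(2))

instance
proof
  fix t u v :: "('a, 'b) tensor" and c :: complex
  show "(t + u) * v = t * v + u * v" "v * (t + u) = v * t + v * u" for t u v :: "('a, 'b) tensor"
    by (rule tensor_times_simps)+
  show "(c *\<^sub>C t) * u = c *\<^sub>C (t * u)" "t * (c *\<^sub>C u) = c *\<^sub>C (t * u)"
    by (rule tensor_times_simps)+
  show "1 * t = t"
    by (induction t) (auto simp: one_tensor_def tensor_times_zero tensor_times_pure tensor_times_simps)
  show "t * 1 = t"
    by (induction t) (auto simp: one_tensor_def tensor_times_zero tensor_times_pure tensor_times_simps)
  have A: "(a \<otimes>\<^sub>t b) * (c \<otimes>\<^sub>t d) * v = (a \<otimes>\<^sub>t b) * ((c \<otimes>\<^sub>t d) * v)" for a c :: 'a and b d :: 'b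
    by (induction v) (auto simp: tensor_times_zero tensor_times_pure tensor_times_simps mult.assoc)
  have B: "(a \<otimes>\<^sub>t b) * u * v = (a \<otimes>\<^sub>t b) * (u * v)" for a :: 'a and b :: 'b
    by (induction u) (auto simp: tensor_times_zero tensor_times_simps A)
  show "t * u * v = t * (u * v)"
    by (induction t) (auto simp: tensor_times_zero tensor_times_simps B)
  show "(0 :: ('a, 'b) tensor) \<noteq> 1"
  proof
    assume 01: "(0 :: ('a, 'b) tensor) = 1"
    obtain \<phi> :: "'a \<Rightarrow> complex" where \<phi>: "clinear \<phi>" "\<phi> 1 = 1" using exists_functional_one by blast
    obtain \<psi> :: "'b \<Rightarrow> complex" where \<psi>: "clinear \<psi>" "\<psi> 1 = 1" using exists_functional_one by blast
    have bil: "cbilinear (\<lambda>a b. \<phi> a * \<psi> b)"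
      using \<phi>(1) \<psi>(1) by (auto simp: cbilinear_iff clinear_iff algebra_simps)
    have "tensor_lift (\<lambda>a b. \<phi> a * \<psi> b) (1 \<otimes>\<^sub>t 1) = 1"
      using bil \<phi>(2) \<psi>(2) by simp
    then show False
      using 01 bil by (metis one_tensor_def tensor_lift_zero zero_neq_one)
  qed
qed

end

lemma pure_tensor_mult [simp]: "(a \<otimes>\<^sub>t b) * (c \<otimes>\<^sub>t d) = (a * c) \<otimes>\<^sub>t (b * d)"
  by (rule tensor_times_pure)


section \<open>Triangular Hopf algebras\<close>

locale hopf_algebra =
  fixes \<Delta> :: "'h::complex_algebra_1 \<Rightarrow> ('h, 'h) tensor"
    and \<epsilon> :: "'h \<Rightarrow> complex"
    and S :: "'h \<Rightarrow> 'h"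
  assumes clinear_comult: "clinear \<Delta>"
    and comult_mult: "\<Delta> (x * y) = \<Delta> x * \<Delta> y"
    and comult_one: "\<Delta> 1 = 1"
    and clinear_counit: "clinear \<epsilon>"
    and counit_mult: "\<epsilon> (x * y) = \<epsilon> x * \<epsilon> y"
    and counit_one: "\<epsilon> 1 = 1"
    and coassoc: "tensor_assoc (tensor_map \<Delta> id (\<Delta> x)) = tensor_map id \<Delta> (\<Delta> x)"
    and counit_left: "tensor_lift (\<lambda>a b. \<epsilon> a *\<^sub>C b) (\<Delta> x) = x"
    and counit_right: "tensor_lift (\<lambda>a b. \<epsilon> b *\<^sub>C a) (\<Delta> x) = x"
    and clinear_antipode: "clinear S"
    and antipode_left: "tensor_lift (\<lambda>a b. S a * b) (\<Delta> x) = \<epsilon> x *\<^sub>C 1"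
    and antipode_right: "tensor_lift (\<lambda>a b. a * S b) (\<Delta> x) = \<epsilon> x *\<^sub>C 1"

text \<open>The three placements of an element of H \<open>\<otimes>\<close> H in H \<open>\<otimes>\<close> (H \<open>\<otimes>\<close> H).\<close>

definition leg12 :: "('h::complex_algebra_1, 'h) tensor \<Rightarrow> ('h, ('h, 'h) tensor) tensor"
  where "leg12 = tensor_lift (\<lambda>a b. a \<otimes>\<^sub>t (b \<otimes>\<^sub>t 1))"

definition leg13 :: "('h::complex_algebra_1, 'h) tensor \<Rightarrow> ('h, ('h, 'h) tensor) tensor"
  where "leg13 = tensor_lift (\<lambda>a b. a \<otimes>\<^sub>t (1 \<otimes>\<^sub>t b))"

definition leg23 :: "('h::complex_algebra_1, 'h) tensor \<Rightarrow> ('h, ('h, 'h) tensor) tensor"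
  where "leg23 t = 1 \<otimes>\<^sub>t t"

locale quasitriangular_hopf_algebra = hopf_algebra \<Delta> \<epsilon> S
  for \<Delta> :: "'h::complex_algebra_1 \<Rightarrow> ('h, 'h) tensor" and \<epsilon> :: "'h \<Rightarrow> complex" and S :: "'h \<Rightarrow> 'h" +
  fixes R :: "('h, 'h) tensor"
  assumes R_conj: "\<exists>R'. R * R' = 1 \<and> R' * R = 1 \<and> (\<forall>x. tensor_flip (\<Delta> x) = R * \<Delta> x * R')"
    and hexagon_left: "tensor_assoc (tensor_map \<Delta> id R) = leg13 R * leg23 R"
    and hexagon_right: "tensor_map id \<Delta> R = leg13 R * leg12 R"

locale triangular_hopf_algebra = quasitriangular_hopf_algebra +
  assumes R21_R: "tensor_flip R * R = 1"


section \<open>Finite-dimensional representations and categorical dimension\<close>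

locale algebra_representation =
  fixes \<rho> :: "'h::complex_algebra_1 \<Rightarrow> 'v::complex_vector \<Rightarrow> 'v"
  assumes cbilinear_rep: "cbilinear \<rho>"
    and rep_one: "\<rho> 1 v = v"
    and rep_mult: "\<rho> (x * y) v = \<rho> x (\<rho> y v)"

locale finite_dimensional_representation = algebra_representation \<rho>
  for \<rho> :: "'h::complex_algebra_1 \<Rightarrow> 'v::complex_vector \<Rightarrow> 'v" +
  assumes finite_dimensional:
    "\<exists>B. finite_dimensional_vector_space (scaleC :: complex \<Rightarrow> 'v \<Rightarrow> 'v) B"

typedef (overloaded) 'v dual = "{f :: 'v::complex_vector \<Rightarrow> complex. clinear f}"
  morphisms dual_apply Abs_dual
  by (rule exI[of _ "\<lambda>_. 0"]) (simp add: clinear_iff)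

setup_lifting type_definition_dual

instantiation dual :: (complex_vector) complex_vector
begin

lift_definition zero_dual :: "'a dual" is "\<lambda>_. 0"
  by (simp add: clinear_iff)
lift_definition plus_dual :: "'a dual \<Rightarrow> 'a dual \<Rightarrow> 'a dual" is "\<lambda>f g v. f v + g v"
  by (simp add: clinear_iff algebra_simps)
lift_definition uminus_dual :: "'a dual \<Rightarrow> 'a dual" is "\<lambda>f v. - f v"
  by (simp add: clinear_iff)
lift_definition minus_dual :: "'a dual \<Rightarrow> 'a dual \<Rightarrow> 'a dual" is "\<lambda>f g v. f v - g v"
  by (simp add: clinear_iff algebra_simps)
lift_definition scaleC_dual :: "complex \<Rightarrow> 'a dual \<Rightarrow> 'a dual" is "\<lambda>c f v. c * f v"
  by (simp add: clinear_iff algebra_simps)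

instance
  by standard (transfer; simp add: fun_eq_iff algebra_simps)+

end

text \<open>The dual representation, \<open>(h f)(v) = f (S(h) v)\<close>.\<close>

definition dual_rep ::
  "('h \<Rightarrow> 'h) \<Rightarrow> ('h \<Rightarrow> 'v \<Rightarrow> 'v) \<Rightarrow> 'h::complex_algebra_1 \<Rightarrow> 'v::complex_vector dual \<Rightarrow> 'v dual"
  where "dual_rep S \<rho> h f = Abs_dual (\<lambda>v. dual_apply f (\<rho> (S h) v))"

text \<open>The action of an element of H \<open>\<otimes>\<close> H on V \<open>\<otimes>\<close> W, given actions of H on V and W.\<close>

definition tensor_act ::
  "('h::complex_algebra_1 \<Rightarrow> 'v \<Rightarrow> 'v) \<Rightarrow> ('h \<Rightarrow> 'w \<Rightarrow> 'w) \<Rightarrow> ('h, 'h) tensor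
    \<Rightarrow> ('v::complex_vector, 'w::complex_vector) tensor \<Rightarrow> ('v, 'w) tensor"
  where "tensor_act \<rho> \<sigma> T x = tensor_lift (\<lambda>a b. tensor_map (\<rho> a) (\<sigma> b) x) T"

definition braiding ::
  "('h, 'h) tensor \<Rightarrow> ('h::complex_algebra_1 \<Rightarrow> 'v \<Rightarrow> 'v) \<Rightarrow> ('h \<Rightarrow> 'w \<Rightarrow> 'w)
    \<Rightarrow> ('v::complex_vector, 'w::complex_vector) tensor \<Rightarrow> ('w, 'v) tensor"
  where "braiding R \<rho> \<sigma> x = tensor_flip (tensor_act \<rho> \<sigma> R x)"

definition ev :: "('v::complex_vector dual, 'v) tensor \<Rightarrow> complex"
  where "ev = tensor_lift dual_apply"

definition coordinate :: "'v::complex_vector set \<Rightarrow> 'v \<Rightarrow> 'v dual"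
  where "coordinate B b = Abs_dual (\<lambda>v. complex_vector.representation B v b)"

text \<open>Only meaningful for finite-dimensional V; the value does not depend on the basis chosen,
  see \<open>coev_basis\<close> below.\<close>

definition coev :: "complex \<Rightarrow> ('v::complex_vector, 'v dual) tensor"
  where "coev c =
    (let B = (SOME B. complex_vector.independent B \<and> complex_vector.span B = UNIV)
     in c *\<^sub>C (\<Sum>b\<in>B. b \<otimes>\<^sub>t coordinate B b))"

text \<open>The composition is a linear endomorphism of \<open>1 = \<complex>\<close>, identified with the scalar by which
  it acts.\<close>

definition categorical_dim ::
  "('h::complex_algebra_1 \<Rightarrow> 'h) \<Rightarrow> ('h, 'h) tensor \<Rightarrow> ('h \<Rightarrow> 'v::complex_vector \<Rightarrow> 'v) \<Rightarrow> complex"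
  where "categorical_dim S R \<rho> = (ev \<circ> braiding R \<rho> (dual_rep S \<rho>) \<circ> coev) 1"

lemma dual_apply_coordinate:
  assumes "complex_vector.independent B" "complex_vector.span B = UNIV"
  shows "dual_apply (coordinate B b) v = complex_vector.representation B v b"
  unfolding coordinate_def
  by (subst Abs_dual_inverse)
     (auto simp: clinear_iff assms complex_vector.representation_add complex_vector.representation_scale)

lemma cbilinear_dual_apply: "cbilinear dual_apply"
  using dual_apply
  by (auto simp: cbilinear_iff clinear_iff plus_dual.rep_eq scaleC_dual.rep_eq)

lemma dual_apply_simps:
  fixes f g :: "'v::complex_vector dual" and v w :: 'v
  shows
  "dual_apply (f + g) v = dual_apply f v + dual_apply g v"
  "dual_apply f (v + w) = dual_apply f v + dual_apply f w"
  "dual_apply (c *\<^sub>C f) v = c * dual_apply f v"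
  "dual_apply f (c *\<^sub>C v) = c * dual_apply f v"
  using cbilinear_dual_apply[where 'a = 'v] unfolding cbilinear_iff by auto

lemma ev_pure [simp]: "ev (f \<otimes>\<^sub>t v) = dual_apply f v"
  by (simp add: ev_def cbilinear_dual_apply)

lemma finite_independent:
  fixes B B' :: "'v::complex_vector set"
  assumes "complex_vector.span B = UNIV" "finite B" "complex_vector.independent B'"
  shows "finite B'"
  using complex_vector.independent_span_bound[OF assms(2,3)] assms(1) by simp

lemma representation_expand:
  fixes B :: "'v::complex_vector set"
  assumes "complex_vector.independent B" "complex_vector.span B = UNIV" "finite B"
  shows "v = (\<Sum>b\<in>B. complex_vector.representation B v b *\<^sub>C b)"
  using complex_vector.sum_representation_eq[OF assms(1) _ assms(3) subset_refl, of v] assms(2) by simp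

lemma pure_tensor_sum_left: "(\<Sum>i\<in>A. f i) \<otimes>\<^sub>t y = (\<Sum>i\<in>A. f i \<otimes>\<^sub>t y)"
  using clinear_sum[of "\<lambda>x. x \<otimes>\<^sub>t y"] by (simp add: clinear_iff pure_tensor_simps)

lemma pure_tensor_sum_right: "x \<otimes>\<^sub>t (\<Sum>i\<in>A. f i) = (\<Sum>i\<in>A. x \<otimes>\<^sub>t f i)"
  using clinear_sum[of "\<lambda>y. x \<otimes>\<^sub>t y"] by (simp add: clinear_iff pure_tensor_simps)

lemma dual_apply_sum: "dual_apply (\<Sum>i\<in>A. f i) v = (\<Sum>i\<in>A. dual_apply (f i) v)"
  using cbilinear_dual_apply unfolding cbilinear_def
  by (intro clinear_sum[of "\<lambda>f. dual_apply f v"]) blast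

lemma coev_element_unique:
  fixes B B' :: "'v::complex_vector set"
  assumes B: "complex_vector.independent B" "complex_vector.span B = UNIV" "finite B"
    and B': "complex_vector.independent B'" "complex_vector.span B' = UNIV" "finite B'"
  shows "(\<Sum>b\<in>B. b \<otimes>\<^sub>t coordinate B b) = (\<Sum>b\<in>B'. b \<otimes>\<^sub>t coordinate B' b)"
proof -
  let ?r = "\<lambda>b b'. complex_vector.representation B b' b"
  have coord: "coordinate B b = (\<Sum>b'\<in>B'. ?r b b' *\<^sub>C coordinate B' b')" for b
  proof -
    have "dual_apply (coordinate B b) v = dual_apply (\<Sum>b'\<in>B'. ?r b b' *\<^sub>C coordinate B' b') v" for v
    proof -
      have lin: "clinear (dual_apply (coordinate B b))" using dual_apply by blast
      have sc: "dual_apply (coordinate B b) (c *\<^sub>C w) = c * dual_apply (coordinate B b) w" for c w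
        using lin by (simp add: clinear_iff)
      have "dual_apply (coordinate B b) v =
          dual_apply (coordinate B b) (\<Sum>b'\<in>B'. complex_vector.representation B' v b' *\<^sub>C b')"
        by (rule arg_cong[OF representation_expand[OF B']])
      also have "\<dots> = (\<Sum>b'\<in>B'. complex_vector.representation B' v b' * ?r b b')"
        by (simp only: clinear_sum[OF lin] sc)
           (simp only: dual_apply_coordinate[OF B(1,2)])
      finally show ?thesis
        by (simp add: dual_apply_sum scaleC_dual.rep_eq dual_apply_coordinate[OF B'(1,2)] mult.commute)
    qed
    then show ?thesis by (simp only: dual_apply_inject[symmetric] fun_eq_iff simp_thms)
  qed
  have "(\<Sum>b\<in>B. b \<otimes>\<^sub>t coordinate B b) = (\<Sum>b\<in>B. \<Sum>b'\<in>B'. (?r b b' *\<^sub>C b) \<otimes>\<^sub>t coordinate B' b')"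
    by (rule sum.cong[OF refl], subst coord)
       (simp only: pure_tensor_sum_right pure_tensor_simps)
  also have "\<dots> = (\<Sum>b'\<in>B'. (\<Sum>b\<in>B. ?r b b' *\<^sub>C b) \<otimes>\<^sub>t coordinate B' b')"
    by (subst sum.swap) (simp only: pure_tensor_sum_left)
  also have "\<dots> = (\<Sum>b'\<in>B'. b' \<otimes>\<^sub>t coordinate B' b')"
    by (simp only: representation_expand[OF B, symmetric])
  finally show ?thesis .
qed

lemma coev_basis:
  fixes B :: "'v::complex_vector set"
  assumes B: "complex_vector.independent B" "complex_vector.span B = UNIV" "finite B"
  shows "coev c = c *\<^sub>C (\<Sum>b\<in>B. b \<otimes>\<^sub>t coordinate B b)"
proof -
  define B' :: "'v set" where
    "B' = (SOME B. complex_vector.independent B \<and> complex_vector.span B = UNIV)"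
  have "complex_vector.independent B' \<and> complex_vector.span B' = UNIV"
    unfolding B'_def by (rule someI[of _ B]) (use B in simp)
  then have B': "complex_vector.independent B'" "complex_vector.span B' = UNIV" by auto
  moreover have "finite B'" by (rule finite_independent[OF B(2,3) B'(1)])
  ultimately show ?thesis
    using coev_element_unique[OF B' _ B] by (simp add: coev_def Let_def B'_def[symmetric])
qed

text \<open>The two triangle identities for \<open>coev\<close> and \<open>ev\<close>, with the
  unit and associativity constraints suppressed.\<close>

lemma triangle_left:
  fixes B :: "'v::complex_vector set" and v :: 'v
  assumes B: "complex_vector.independent B" "complex_vector.span B = UNIV" "finite B"
  shows "tensor_lift (\<lambda>w f. dual_apply f v *\<^sub>C w) (coev 1) = v"
proof -
  have bil: "cbilinear (\<lambda>w f. dual_apply f v *\<^sub>C w)"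
    by (auto simp: cbilinear_iff dual_apply_simps scaleC_add_left scaleC_add_right mult.commute)
  show ?thesis
    using representation_expand[OF B, of v, symmetric]
    by (simp add: coev_basis[OF B] clinear_sum[OF clinear_tensor_lift[OF bil]] bil
        dual_apply_coordinate[OF B(1,2)])
qed

lemma triangle_right:
  fixes B :: "'v::complex_vector set" and g :: "'v dual"
  assumes B: "complex_vector.independent B" "complex_vector.span B = UNIV" "finite B"
  shows "tensor_lift (\<lambda>w f. dual_apply g w *\<^sub>C f) (coev 1) = g"
proof -
  have bil: "cbilinear (\<lambda>w f. dual_apply g w *\<^sub>C f)"
    by (auto simp: cbilinear_iff dual_apply_simps scaleC_add_left scaleC_add_right mult.commute)
  have lin: "clinear (dual_apply g)" using dual_apply by blast
  have sc: "dual_apply g (c *\<^sub>C w) = c * dual_apply g w" for c w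
    using lin by (simp add: clinear_iff)
  have "dual_apply (\<Sum>b\<in>B. dual_apply g b *\<^sub>C coordinate B b) v = dual_apply g v" for v
  proof -
    have "dual_apply g v = dual_apply g (\<Sum>b\<in>B. complex_vector.representation B v b *\<^sub>C b)"
      by (rule arg_cong[OF representation_expand[OF B]])
    also have "\<dots> = (\<Sum>b\<in>B. complex_vector.representation B v b * dual_apply g b)"
      by (simp only: clinear_sum[OF lin] sc)
    finally show ?thesis
      by (simp add: dual_apply_sum scaleC_dual.rep_eq dual_apply_coordinate[OF B(1,2)] mult.commute)
  qed
  then have "(\<Sum>b\<in>B. dual_apply g b *\<^sub>C coordinate B b) = g"
    by (simp add: dual_apply_inject[symmetric] fun_eq_iff)
  then show ?thesis
    by (simp add: coev_basis[OF B] clinear_sum[OF clinear_tensor_lift[OF bil]] bil)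
qed

end

theory Submission
  imports Defs "HOL-Library.FuncSet" "HOL-Combinatorics.Permutations"
begin

text \<open>The proof is an elementary form of Deligne's argument that dimensions are integers in a symmetric
  tensor category of moderate growth. Write \<open>R = \<Sum> a k \<otimes> b k\<close>. The categorical dimension \<open>d\<close>
  of \<open>V\<close> is the trace on \<open>V\<close> of the Drinfeld element \<open>u = \<Sum> S(b k) a k\<close>. The braiding of \<open>V\<close> with
  itself is an involution satisfying the braid relation, so the symmetric group on \<open>n\<close> letters acts on the
  \<open>n\<close>-fold tensor power of \<open>V\<close> (\<open>act_eq_if_same_permutation\<close>). The partial trace over the last
  factor, twisted by \<open>u\<close>, sends \<open>1\<close> to \<open>d\<close> and the last generator to \<open>1\<close>; the latter comes from the
  identity \<open>\<Sum> b k * u * a k = 1\<close> (\<open>drinfeld_conj\<close>). Hence it behaves like a Markov trace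
  on group algebras of symmetric groups.

  This trace has an algebraic consequence. The pairing of the group algebra on \<open>n + 1\<close> letters with the
  transpositions \<open>(n j)\<close>, followed by the trace down to \<open>n\<close> letters, is multiplication by
  \<open>J + d\<close>, where \<open>J\<close> is the Jucys-Murphy element \<open>\<Sum>i<n. (i n)\<close>. The eigenvalues of \<open>J\<close> are
  integers (\<open>jucys_murphy_eigenvalue_integer\<close>). So if \<open>d\<close> is not an integer, then \<open>J + d\<close> is
  injective, and by induction on \<open>n\<close> the group algebra acts faithfully on every tensor power
  (\<open>permutations_independent\<close>). Its dimension \<open>n!\<close> then is at most \<open>(dim V) ^ (2 * n)\<close>, which is
  impossible for large \<open>n\<close> (\<open>quantum_trace_integer\<close>).\<close>

section \<open>Underdetermined linear systems\<close>

text \<open>Gaussian elimination: one unknown is spent on each equation, so one unknown stays free.\<close>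

lemma underdetermined_system:
  fixes M :: "'s \<Rightarrow> 't \<Rightarrow> 'a::field"
  assumes "finite S" "finite T" "card T < card S"
  shows "\<exists>x. (\<exists>s\<in>S. x s \<noteq> 0) \<and> (\<forall>t\<in>T. (\<Sum>s\<in>S. x s * M s t) = 0)"
  using assms(2,1,3)
proof (induction T arbitrary: S M rule: finite_induct)
  case empty
  then obtain s where "s \<in> S" by fastforce
  then show ?case by (intro exI[of _ "\<lambda>_. 1"]) auto
next
  case (insert t T)
  show ?case
  proof (cases "\<forall>s\<in>S. M s t = 0")
    case True
    have "card T < card S" using insert by simp
    then obtain x where "\<exists>s\<in>S. x s \<noteq> 0" "\<forall>t\<in>T. (\<Sum>s\<in>S. x s * M s t) = 0"
      using insert.IH[OF insert.prems(1)] by blast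
    with True show ?thesis by (intro exI[of _ x]) auto
  next
    case False
    then obtain r where r: "r \<in> S" "M r t \<noteq> 0" by blast
    let ?S = "S - {r}"
    define N where "N s t' = M s t' - M s t / M r t * M r t'" for s t'
    have fin: "finite ?S" and card: "card T < card ?S"
      using insert r(1) by auto
    obtain x where x: "\<exists>s\<in>?S. x s \<noteq> 0" "\<And>t'. t' \<in> T \<Longrightarrow> (\<Sum>s\<in>?S. x s * N s t') = 0"
      using insert.IH[OF fin card, of N] by blast
    define y where "y = x(r := - (\<Sum>s\<in>?S. x s * M s t) / M r t)"
    have expand: "(\<Sum>s\<in>S. y s * M s t') = y r * M r t' + (\<Sum>s\<in>?S. x s * M s t')" for t'
      using r(1) insert.prems(1) by (subst sum.remove[of _ r]) (auto simp: y_def intro!: sum.cong)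
    have "(\<Sum>s\<in>S. y s * M s t') = 0" if "t' \<in> insert t T" for t'
    proof (cases "t' = t")
      case True
      then show ?thesis using r(2) by (simp add: expand) (simp add: y_def)
    next
      case False
      then have "0 = (\<Sum>s\<in>?S. x s * N s t')" using x(2) that by simp
      also have "\<dots> = (\<Sum>s\<in>?S. x s * M s t') - (\<Sum>s\<in>?S. x s * M s t) / M r t * M r t'"
        by (simp add: N_def right_diff_distrib sum_subtractf sum_distrib_right sum_divide_distrib
            mult.assoc)
      finally show ?thesis by (simp add: expand) (simp add: y_def)
    qed
    moreover have "\<exists>s\<in>S. y s \<noteq> 0" using x(1) by (auto simp: y_def)
    ultimately show ?thesis by blast
  qed
qed


section \<open>Jucys-Murphy elements have integer eigenvalues\<close>

text \<open>A function \<open>f\<close> on permutations stands for the group algebra element with coefficients \<open>f p\<close>.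
  In these terms \<open>jucys_murphy k\<close> is right multiplication by the Jucys-Murphy element
  \<open>(0 k) + (1 k) + \<dots> + (k-1 k)\<close>.\<close>

definition jucys_murphy :: "nat \<Rightarrow> ((nat \<Rightarrow> nat) \<Rightarrow> complex) \<Rightarrow> (nat \<Rightarrow> nat) \<Rightarrow> complex"
  where "jucys_murphy k f p = (\<Sum>i<k. f (p \<circ> transpose i k))"

lemma jucys_murphy_linear:
  "jucys_murphy k (\<lambda>p. f p + g p) = (\<lambda>p. jucys_murphy k f p + jucys_murphy k g p)"
  "jucys_murphy k (\<lambda>p. c * f p) = (\<lambda>p. c * jucys_murphy k f p)"
  by (simp_all add: jucys_murphy_def fun_eq_iff sum.distrib sum_distrib_left)

text \<open>With \<open>s\<close> right multiplication by \<open>(k k+1)\<close>, and \<open>X\<close>, \<open>Y\<close> the elements number \<open>k\<close> and \<open>k+1\<close>,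
  this is the relation \<open>Y = s X s + s\<close> of the degenerate affine Hecke algebra: conjugation
  by \<open>(k k+1)\<close> turns \<open>(i k)\<close> into \<open>(i k+1)\<close>, and the summand \<open>(k k+1)\<close> of \<open>Y\<close> is left over.\<close>

lemma jucys_murphy_Suc:
  "jucys_murphy (Suc k) f p =
     jucys_murphy k (\<lambda>q. f (q \<circ> transpose k (Suc k))) (p \<circ> transpose k (Suc k))
     + f (p \<circ> transpose k (Suc k))"
proof -
  have "transpose k (Suc k) \<circ> (transpose i k \<circ> transpose k (Suc k)) = transpose i (Suc k)"
    if "i < k" for i
    using that by (auto simp: fun_eq_iff transpose_def)
  then show ?thesis
    by (simp add: jucys_murphy_def comp_assoc)
qed

text \<open>Conjugation by \<open>(i k)\<close> only permutes the summands \<open>(j k+1)\<close> with \<open>j \<le> k\<close>.\<close>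

lemma jucys_murphy_commute:
  "jucys_murphy k (jucys_murphy (Suc k) f) = jucys_murphy (Suc k) (jucys_murphy k f)"
proof
  fix p
  have "jucys_murphy k (jucys_murphy (Suc k) f) p =
      (\<Sum>i<k. \<Sum>j<Suc k. f (p \<circ> transpose i k \<circ> transpose j (Suc k)))"
    by (simp add: jucys_murphy_def)
  also have "\<dots> = (\<Sum>i<k. \<Sum>j<Suc k. f (p \<circ> transpose j (Suc k) \<circ> transpose i k))"
  proof (rule sum.cong[OF refl])
    fix i assume i: "i \<in> {..<k}"
    have perm: "transpose i k permutes {..<Suc k}"
      using i by (intro permutes_swap_id) auto
    have "transpose i k \<circ> transpose j (Suc k) = transpose (transpose i k j) (Suc k) \<circ> transpose i k"
      if "j < Suc k" for j
      using that i by (auto simp: fun_eq_iff transpose_def)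
    then have "(\<Sum>j<Suc k. f (p \<circ> transpose i k \<circ> transpose j (Suc k)))
        = (\<Sum>j<Suc k. f (p \<circ> transpose (transpose i k j) (Suc k) \<circ> transpose i k))"
      by (intro sum.cong) (auto simp: comp_assoc)
    also have "\<dots> = (\<Sum>j<Suc k. f (p \<circ> transpose j (Suc k) \<circ> transpose i k))"
      by (subst (2) sum.permute[OF perm]) (simp add: o_def)
    finally show "(\<Sum>j<Suc k. f (p \<circ> transpose i k \<circ> transpose j (Suc k))) = \<dots>" .
  qed
  also have "\<dots> = jucys_murphy (Suc k) (jucys_murphy k f) p"
    by (subst sum.swap) (simp add: jucys_murphy_def)
  finally show "jucys_murphy k (jucys_murphy (Suc k) f) p = \<dots>" .
qed

text \<open>An eigenvalue of \<open>Y\<close> is an eigenvalue of \<open>X\<close>, or it differs from such an eigenvalue by \<open>1\<close>.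
  Suppose \<open>Y f = b f\<close>, where \<open>b\<close>, \<open>b + 1\<close> and \<open>b - 1\<close> are not eigenvalues of \<open>X\<close>.
  Then \<open>s (X - b) f + f\<close> is multiplied by \<open>b\<close> under \<open>X\<close>, by \<open>Y s = s X + 1\<close> and
  \<open>X Y = Y X\<close>, hence zero. This forces \<open>(X - b)\<^sup>2 f = f\<close>, and then both factors of
  \<open>(X - b - 1) (X - b + 1) f = 0\<close> can be cancelled. Since the element number \<open>0\<close> is zero,
  all eigenvalues are integers.\<close>

lemma jucys_murphy_eigenvalue_integer:
  assumes "b \<notin> \<int>" "\<And>p. jucys_murphy k f p = b * f p"
  shows "f p = 0"
  using assms
proof (induction k arbitrary: b f p)
  case 0
  then have "b \<noteq> 0" "b * f p = 0" by (auto simp: jucys_murphy_def)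
  then show ?case by simp
next
  case (Suc k)
  let ?t = "transpose k (Suc k)"
  let ?X = "jucys_murphy k"
  define s where "s g = (\<lambda>p. g (p \<circ> ?t))" for g :: "(nat \<Rightarrow> nat) \<Rightarrow> complex"
  have ss: "s (s g) = g" for g
    by (simp add: s_def comp_assoc)
  have s_lin: "s (\<lambda>p. g p + h p) = (\<lambda>p. s g p + s h p)" "s (\<lambda>p. c * g p) = (\<lambda>p. c * s g p)" for g h c
    by (simp_all add: s_def)
  have Y: "jucys_murphy (Suc k) g = (\<lambda>p. s (?X (s g)) p + s g p)" for g
    by (simp add: fun_eq_iff jucys_murphy_Suc s_def)
  have Yf: "jucys_murphy (Suc k) f = (\<lambda>p. b * f p)"
    using Suc.prems(2) by blast
  have Xsf: "?X (s f) = (\<lambda>p. b * s f p - f p)"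
  proof -
    have "s (\<lambda>p. s (?X (s f)) p + s f p) = s (\<lambda>p. b * f p)"
      using Y[of f] Yf by simp
    then have "(\<lambda>p. ?X (s f) p + f p) = (\<lambda>p. b * s f p)" by (simp add: s_lin ss)
    then show ?thesis by (simp add: fun_eq_iff eq_diff_eq)
  qed
  \<comment> \<open>\<open>w = (X - b) f\<close> is again an eigenvector of \<open>Y\<close> for \<open>b\<close>, because \<open>X\<close> and \<open>Y\<close> commute\<close>
  define w where "w = (\<lambda>p. ?X f p + (- b) * f p)"
  have Yw: "jucys_murphy (Suc k) w = (\<lambda>p. b * w p)"
    unfolding w_def jucys_murphy_linear
    by (simp add: jucys_murphy_commute[symmetric] Yf jucys_murphy_linear algebra_simps)
  have Xsw: "?X (s w) = (\<lambda>p. b * s w p - w p)"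
  proof -
    have "s (\<lambda>p. s (?X (s w)) p + s w p) = s (\<lambda>p. b * w p)"
      using Y[of w] Yw by simp
    then have "(\<lambda>p. ?X (s w) p + w p) = (\<lambda>p. b * s w p)" by (simp add: s_lin ss)
    then show ?thesis by (simp add: fun_eq_iff eq_diff_eq)
  qed
  have "?X (\<lambda>p. s w p + f p) p = b * (s w p + f p)" for p
    by (simp add: jucys_murphy_linear Xsw) (simp add: w_def algebra_simps)
  then have "s w p + f p = 0" for p
    using Suc.IH[OF Suc.prems(1)] by blast
  then have "s w = (\<lambda>p. (- 1) * f p)" by (simp add: fun_eq_iff eq_neg_iff_add_eq_0)
  then have "s (s w) = (\<lambda>p. (- 1) * s f p)" by (simp only: s_lin)
  then have w: "w = (\<lambda>p. (- 1) * s f p)" by (simp only: ss)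
  have Xw: "?X w p = b * w p + f p" for p
    by (subst w, simp only: jucys_murphy_linear Xsf) (simp add: w algebra_simps)
  have Xf: "?X f p = b * f p + w p" for p
    by (simp add: w_def)
  \<comment> \<open>Hence \<open>(X - b)\<^sup>2 f = f\<close>, so \<open>f \<plusminus> w\<close> are eigenvectors with eigenvalues \<open>b \<plusminus> 1\<close>\<close>
  have "?X (\<lambda>p. f p + w p) p = (b + 1) * (f p + w p)" for p
    by (simp add: jucys_murphy_linear Xf Xw algebra_simps)
  moreover have "b + 1 \<notin> \<int>" using Suc.prems(1) by (metis Ints_1 Ints_diff add_diff_cancel_right')
  ultimately have 1: "f p + w p = 0" for p using Suc.IH by blast
  have "?X (\<lambda>p. f p + (- 1) * w p) p = (b - 1) * (f p + (- 1) * w p)" for p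
    by (simp only: jucys_murphy_linear Xf Xw) (simp add: algebra_simps)
  moreover have "b - 1 \<notin> \<int>" using Suc.prems(1) by (metis Ints_1 Ints_add diff_add_cancel)
  ultimately have 2: "f p + (- 1) * w p = 0" for p using Suc.IH by blast
  show ?case using 1[of p] 2[of p] by simp
qed


section \<open>The Coxeter presentation of the symmetric group\<close>

lemma apply_adj_transps_append:
  "apply_adj_transps (v @ w) = apply_adj_transps v \<circ> apply_adj_transps w"
  by (induction v) (simp_all add: comp_assoc)

lemma apply_adj_transps_rev:
  "apply_adj_transps (rev w) \<circ> apply_adj_transps w = id"
  "apply_adj_transps w \<circ> apply_adj_transps (rev w) = id"
proof -
  have *: "apply_adj_transps (rev w) (apply_adj_transps w x) = x" for w x
    by (induction w arbitrary: x) (simp_all add: apply_adj_transps_append)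
  show "apply_adj_transps (rev w) \<circ> apply_adj_transps w = id"
    "apply_adj_transps w \<circ> apply_adj_transps (rev w) = id"
    using *[of w] *[of "rev w"] by (auto simp: fun_eq_iff)
qed

text \<open>The descending word \<open>[m-1, \<dots>, i]\<close> multiplies to a cycle that carries \<open>i\<close> up to \<open>m\<close>.\<close>

lemma apply_adj_transps_descending:
  "i \<le> m \<Longrightarrow> apply_adj_transps (rev [i..<m]) i = m"
  by (induction m) (auto simp: le_Suc_eq)

lemma apply_adj_transps_conj:
  assumes "i < n"
  shows "apply_adj_transps ([i..<n - 1] @ [n - 1] @ rev [i..<n - 1]) = transpose i n"
  using assms
proof (induction "n - i" arbitrary: i)
  case (Suc d)
  show ?case
  proof (cases "Suc i = n")
    case True
    then show ?thesis by (auto simp: apply_adj_transps_append)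
  next
    case False
    then have lt: "Suc i < n" and d: "d = n - Suc i" using Suc by auto
    have upt: "[i..<n - 1] = i # [Suc i..<n - 1]"
      using lt by (intro upt_conv_Cons) auto
    have "apply_adj_transps ([i..<n - 1] @ [n - 1] @ rev [i..<n - 1]) =
        transpose i (Suc i) \<circ> apply_adj_transps ([Suc i..<n - 1] @ [n - 1] @ rev [Suc i..<n - 1])
        \<circ> transpose i (Suc i)"
      unfolding upt by (simp add: apply_adj_transps_append comp_assoc)
    also have "\<dots> = transpose i n"
      unfolding Suc.hyps(1)[OF d lt]
      using lt by (auto simp: fun_eq_iff transpose_def)
    finally show ?thesis .
  qed
qed simp

text \<open>The letter \<open>i\<close> stands for the adjacent transposition \<open>(i i+1)\<close>, which permutes \<open>{..<n}\<close> exactly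
  if \<open>i + 1 < n\<close>; so \<open>letters n\<close> consists of the words in the Coxeter generators of the
  symmetric group on \<open>{..<n}\<close>.\<close>

definition letters :: "nat \<Rightarrow> nat list set"
  where "letters n = {w. \<forall>i\<in>set w. Suc i < n}"

lemma letters_simps [simp]:
  "[] \<in> letters n"
  "i # w \<in> letters n \<longleftrightarrow> Suc i < n \<and> w \<in> letters n"
  "v @ w \<in> letters n \<longleftrightarrow> v \<in> letters n \<and> w \<in> letters n"
  "rev w \<in> letters n \<longleftrightarrow> w \<in> letters n"
  by (auto simp: letters_def)

lemma letters_mono: "w \<in> letters m \<Longrightarrow> m \<le> n \<Longrightarrow> w \<in> letters n"
  unfolding letters_def by fastforce

lemma letters_upt: "j < n \<Longrightarrow> [i..<j] \<in> letters n"
  by (auto simp: letters_def)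

lemma apply_adj_transps_permutes: "w \<in> letters n \<Longrightarrow> apply_adj_transps w permutes {..<n}"
  by (rule permutes_apply_adj_transps) (auto simp: letters_def)

lemma exists_word:
  assumes "p permutes {..<n}"
  shows "\<exists>w \<in> letters n. apply_adj_transps w = p"
  using assms finite_lessThan[of n]
proof (induction rule: permutes_induct)
  case id
  then show ?case by (intro bexI[of _ "[]"]) auto
next
  case (swap a b p)
  then obtain w where w: "w \<in> letters n" "apply_adj_transps w = p" by blast
  have *: "\<exists>v \<in> letters n. apply_adj_transps v = transpose a b" if "a < b" "b < n" for a b
    using that by (intro bexI[of _ "adj_transp_seq a b"])
      (auto simp: adj_transp_seq_correct letters_def set_adj_transp_seq)
  obtain v where "v \<in> letters n" "apply_adj_transps v = transpose a b"
    using *[of a b] *[of b a] swap(1-3) by (metis lessThan_iff linorder_neqE_nat transpose_commute)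
  then show ?case
    using w by (intro bexI[of _ "v @ w"]) (auto simp: apply_adj_transps_append)
qed

text \<open>The Coxeter relations of the symmetric group on \<open>{..<N}\<close>, required only on an invariant set \<open>M\<close>:
  the operators of interest are defined on all functions but satisfy the relations only on
  multilinear ones.\<close>

locale coxeter_action =
  fixes N :: nat and M :: "'a set" and Q :: "nat \<Rightarrow> 'a \<Rightarrow> 'a"
  assumes closed: "Suc i < N \<Longrightarrow> x \<in> M \<Longrightarrow> Q i x \<in> M"
    and involution: "Suc i < N \<Longrightarrow> x \<in> M \<Longrightarrow> Q i (Q i x) = x"
    and braid: "Suc (Suc i) < N \<Longrightarrow> x \<in> M \<Longrightarrow>
      Q i (Q (Suc i) (Q i x)) = Q (Suc i) (Q i (Q (Suc i) x))"
    and far_commute: "Suc i < j \<Longrightarrow> Suc j < N \<Longrightarrow> x \<in> M \<Longrightarrow> Q i (Q j x) = Q j (Q i x)"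
begin

abbreviation act :: "nat list \<Rightarrow> 'a \<Rightarrow> 'a"
  where "act \<equiv> foldr Q"

lemma act_closed: "w \<in> letters N \<Longrightarrow> x \<in> M \<Longrightarrow> act w x \<in> M"
  by (induction w) (auto simp: closed)

lemma act_rev: "w \<in> letters N \<Longrightarrow> x \<in> M \<Longrightarrow> act w (act (rev w) x) = x"
proof (induction w arbitrary: x)
  case (Cons i w)
  then show ?case by (simp add: closed involution)
qed simp

text \<open>Equality in the subgroup of (symmetric group) \<open>\<times>\<close> (bijections of \<open>M\<close>) generated by the pairs of a
  generator and its operator. Showing that the first component determines the second amounts
  to the presentation of the symmetric group by the Coxeter relations.\<close>

definition equivalent :: "nat list \<Rightarrow> nat list \<Rightarrow> bool"  (infix \<open>\<approx>\<close> 50)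
  where "v \<approx> w \<longleftrightarrow> apply_adj_transps v = apply_adj_transps w \<and> (\<forall>x\<in>M. act v x = act w x)"

lemma equivalent_refl: "w \<approx> w"
  by (simp add: equivalent_def)

lemma equivalent_trans [trans]: "u \<approx> v \<Longrightarrow> v \<approx> w \<Longrightarrow> u \<approx> w"
  by (simp add: equivalent_def)

lemma equivalent_sym: "v \<approx> w \<Longrightarrow> w \<approx> v"
  by (simp add: equivalent_def)

lemma equivalent_append:
  "v \<approx> v' \<Longrightarrow> w \<approx> w' \<Longrightarrow> w \<in> letters N \<Longrightarrow> v @ w \<approx> v' @ w'"
  unfolding equivalent_def by (simp add: apply_adj_transps_append) (metis act_closed)

lemma equivalent_cancel: "Suc i < N \<Longrightarrow> [i, i] \<approx> []"
  by (simp add: equivalent_def involution)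

lemma equivalent_commute1: "Suc i < j \<Longrightarrow> Suc j < N \<Longrightarrow> [i, j] \<approx> [j, i]"
  using far_commute[of i j] by (auto simp: equivalent_def fun_eq_iff transpose_def)

lemma equivalent_braid: "Suc (Suc i) < N \<Longrightarrow> [Suc i, i, Suc i] \<approx> [i, Suc i, i]"
  by (auto simp: equivalent_def braid fun_eq_iff transpose_def)

lemma equivalent_commute:
  assumes "w \<in> letters N" "Suc j < N" "\<And>k. k \<in> set w \<Longrightarrow> Suc k < j \<or> Suc j < k"
  shows "w @ [j] \<approx> [j] @ w"
  using assms
proof (induction w)
  case (Cons k w)
  have "[k, j] \<approx> [j, k]"
    using Cons.prems equivalent_commute1[of k j] equivalent_sym[OF equivalent_commute1[of j k]]
    by auto
  then have *: "[k, j] @ w \<approx> [j, k] @ w"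
    using Cons.prems by (intro equivalent_append equivalent_refl) auto
  have "w @ [j] \<approx> [j] @ w" using Cons by simp
  then have "[k] @ (w @ [j]) \<approx> [k] @ ([j] @ w)"
    using Cons.prems by (intro equivalent_append[OF equivalent_refl]) auto
  then show ?case using equivalent_trans * by fastforce
qed (simp add: equivalent_refl)

text \<open>The descending words \<open>[m-1, \<dots>, i]\<close> represent the right cosets of the smaller symmetric group.
  A letter appended to one of them prolongs it, shortens it, or can be moved to its front,
  where it becomes a letter of the smaller group.\<close>

lemma descending_times_letter:
  assumes "m < N" "i \<le> m" "j < m"
  shows "\<exists>w i'. w \<in> letters m \<and> i' \<le> m \<and> rev [i..<m] @ [j] \<approx> w @ rev [i'..<m]"
proof -
  have split: "rev [a..<c] = rev [b..<c] @ rev [a..<b]" if "a \<le> b" "b \<le> c" for a b c :: nat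
    using that by (metis le_Suc_ex rev_append upt_add_eq_append)
  have letters: "rev [a..<b] \<in> letters N" if "b \<le> m" for a b
    using that assms by (simp add: letters_upt)
  consider "Suc j = i" | "j = i" | "Suc j < i" | "i < j" by linarith
  then show ?thesis
  proof cases
    case 1
    then have "rev [i..<m] @ [j] = rev [j..<m]"
      using assms split[of j i m] by (simp flip: 1)
    then show ?thesis
      using assms by (intro exI[of _ "[]"] exI[of _ j]) (simp add: equivalent_refl)
  next
    case 2
    have "rev [i..<m] @ [j] = rev [Suc i..<m] @ [i, i]"
      using assms split[of i "Suc i" m] 2 by simp
    also have "\<dots> \<approx> rev [Suc i..<m] @ []"
      using assms 2 by (intro equivalent_append equivalent_refl equivalent_cancel) auto
    finally show ?thesis
      using assms 2 by (intro exI[of _ "[]"] exI[of _ "Suc i"]) auto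
  next
    case 3
    have "rev [i..<m] @ [j] \<approx> [j] @ rev [i..<m]"
      using assms 3 letters[of m i] by (intro equivalent_commute) auto
    then show ?thesis
      using assms 3 by (intro exI[of _ "[j]"] exI[of _ i]) auto
  next
    case 4
    then obtain l where j: "j = Suc l" by (cases j) auto
    have il: "i \<le> l" using 4 j by simp
    have eq: "rev [i..<m] = rev [Suc j..<m] @ [j, l] @ rev [i..<l]"
      using assms 4 j il split[of i "Suc j" m] split[of i l "Suc j"] by (simp add: upt_rec[of l])
    have "rev [i..<m] @ [j] = rev [Suc j..<m] @ [j, l] @ (rev [i..<l] @ [j])"
      by (simp only: eq append_assoc)
    also have "\<dots> \<approx> rev [Suc j..<m] @ [j, l] @ ([j] @ rev [i..<l])"
      using assms j letters[of l i]
      by (intro equivalent_append equivalent_refl equivalent_commute) auto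
    also have "\<dots> = rev [Suc j..<m] @ [j, l, j] @ rev [i..<l]" by simp
    also have "\<dots> \<approx> rev [Suc j..<m] @ [l, j, l] @ rev [i..<l]"
      using assms j letters[of l i] equivalent_braid[of l]
      by (intro equivalent_append equivalent_refl) auto
    also have "\<dots> = (rev [Suc j..<m] @ [l]) @ [j, l] @ rev [i..<l]" by simp
    also have "\<dots> \<approx> ([l] @ rev [Suc j..<m]) @ [j, l] @ rev [i..<l]"
      using assms j letters[of l i] letters[of m "Suc j"]
      by (intro equivalent_append equivalent_refl equivalent_commute) auto
    also have "\<dots> = [l] @ rev [i..<m]" by (simp only: eq append_assoc)
    finally show ?thesis
      using assms j by (intro exI[of _ "[l]"] exI[of _ i]) auto
  qed
qed

lemma normal_form:
  assumes "m < N" "w \<in> letters (Suc m)"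
  shows "\<exists>v i. v \<in> letters m \<and> i \<le> m \<and> w \<approx> v @ rev [i..<m]"
  using assms(2)
proof (induction w rule: rev_induct)
  case Nil
  show ?case by (intro exI[of _ "[]"] exI[of _ m]) (simp add: equivalent_refl)
next
  case (snoc j w)
  then obtain v i where v: "v \<in> letters m" "i \<le> m" "w \<approx> v @ rev [i..<m]" by auto
  obtain u i' where u: "u \<in> letters m" "i' \<le> m" "rev [i..<m] @ [j] \<approx> u @ rev [i'..<m]"
    using descending_times_letter[of m i j] v assms(1) snoc.prems by auto
  have "w @ [j] \<approx> (v @ rev [i..<m]) @ [j]"
    using snoc.prems v assms(1) by (intro equivalent_append equivalent_refl) auto
  also have "\<dots> = v @ (rev [i..<m] @ [j])" by simp
  also have "\<dots> \<approx> v @ (u @ rev [i'..<m])"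
    using u snoc.prems assms(1) by (intro equivalent_append[OF equivalent_refl]) (auto simp: letters_upt)
  finally show ?case
    using u v by (intro exI[of _ "v @ u"] exI[of _ i']) auto
qed

text \<open>In the normal form \<open>v @ [m-1, \<dots>, i]\<close> the index \<open>i\<close> can be read off from the permutation, as the
  point that is sent to \<open>m\<close>. So equal permutations have the same coset representative, and
  the claim descends to \<open>v\<close>.\<close>

theorem act_eq_if_same_permutation:
  assumes "v \<in> letters N" "w \<in> letters N" "apply_adj_transps v = apply_adj_transps w" "x \<in> M"
  shows "act v x = act w x"
proof -
  have "v \<approx> w" if "m \<le> N" "v \<in> letters m" "w \<in> letters m"
    "apply_adj_transps v = apply_adj_transps w" for m
    using that
  proof (induction m arbitrary: v w)
    case 0
    then have "v = []" "w = []" by (auto simp: letters_def)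
    then show ?case by (simp add: equivalent_refl)
  next
    case (Suc m)
    obtain v' i where v': "v' \<in> letters m" "i \<le> m" "v \<approx> v' @ rev [i..<m]"
      using normal_form[of m v] Suc.prems by auto
    obtain w' j where w': "w' \<in> letters m" "j \<le> m" "w \<approx> w' @ rev [j..<m]"
      using normal_form[of m w] Suc.prems by auto
    have fixm: "apply_adj_transps u m = m" if "u \<in> letters m" for u
      using permutes_not_in[OF apply_adj_transps_permutes[OF that]] by simp
    have im: "apply_adj_transps v i = m"
      using v' fixm by (simp add: equivalent_def apply_adj_transps_append apply_adj_transps_descending)
    have jm: "apply_adj_transps w j = m"
      using w' fixm by (simp add: equivalent_def apply_adj_transps_append apply_adj_transps_descending)
    have "inj (apply_adj_transps v)"
      using Suc.prems(2) apply_adj_transps_permutes permutes_inj by blast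
    then have ij: "i = j"
      using im jm Suc.prems(4) by (metis injD)
    have "apply_adj_transps v' \<circ> apply_adj_transps (rev [i..<m]) =
        apply_adj_transps w' \<circ> apply_adj_transps (rev [i..<m])"
      using v' w' ij Suc.prems(4) by (simp add: equivalent_def apply_adj_transps_append)
    then have "apply_adj_transps v' \<circ> (apply_adj_transps (rev [i..<m]) \<circ> apply_adj_transps [i..<m]) =
        apply_adj_transps w' \<circ> (apply_adj_transps (rev [i..<m]) \<circ> apply_adj_transps [i..<m])"
      by (simp only: comp_assoc[symmetric])
    then have "apply_adj_transps v' = apply_adj_transps w'"
      by (simp add: apply_adj_transps_rev)
    then have "v' \<approx> w'" using Suc v' w' by simp
    then have "v' @ rev [i..<m] \<approx> w' @ rev [i..<m]"
      using Suc.prems(1) by (intro equivalent_append equivalent_refl) (auto simp: letters_upt)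
    then show ?case
      using v'(3) w'(3) ij equivalent_trans equivalent_sym by metis
  qed
  then show ?thesis using assms by (auto simp: equivalent_def)
qed

end


section \<open>The rank of a vector symmetry is an integer\<close>

lemma clinear_sum_fun: "(\<And>k. k \<in> A \<Longrightarrow> clinear (f k)) \<Longrightarrow> clinear (\<lambda>x. \<Sum>k\<in>A. f k x)"
  by (induction A rule: infinite_finite_induct) (auto simp: clinear_iff scaleC_add_right algebra_simps)

lemma clinear_compose: "clinear f \<Longrightarrow> clinear g \<Longrightarrow> clinear (\<lambda>x. f (g x))"
  by (simp add: clinear_iff)

text \<open>Forms on \<open>V \<otimes> \<dots> \<otimes> V\<close> (\<open>n\<close> factors), as functions of an infinite sequence of vectors that depend
  only on its first \<open>n\<close> entries. In this way a single family of operators acts for all \<open>n\<close>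
  at once.\<close>

definition multilinear :: "nat \<Rightarrow> ((nat \<Rightarrow> 'v::complex_vector) \<Rightarrow> complex) \<Rightarrow> bool"
  where "multilinear n F \<longleftrightarrow>
    (\<forall>i<n. \<forall>\<omega>. clinear (\<lambda>v. F (\<omega>(i := v)))) \<and>
    (\<forall>\<omega> \<omega>'. (\<forall>i<n. \<omega> i = \<omega>' i) \<longrightarrow> F \<omega> = F \<omega>')"

lemma multilinear_clinear: "multilinear n F \<Longrightarrow> i < n \<Longrightarrow> clinear (\<lambda>v. F (\<omega>(i := v)))"
  by (simp add: multilinear_def)

lemma multilinear_cong: "multilinear n F \<Longrightarrow> (\<And>i. i < n \<Longrightarrow> \<omega> i = \<omega>' i) \<Longrightarrow> F \<omega> = F \<omega>'"
  unfolding multilinear_def by blast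

lemma multilinear_sum:
  "(\<And>k. k \<in> A \<Longrightarrow> multilinear n (F k)) \<Longrightarrow> multilinear n (\<lambda>\<omega>. \<Sum>k\<in>A. c k * F k \<omega>)"
  unfolding multilinear_def clinear_iff
  by (auto simp: sum.distrib distrib_left sum_distrib_left mult.left_commute intro!: sum.cong)

text \<open>Let \<open>r = \<Sum> \<alpha> k \<otimes> \<beta> k\<close> act on \<open>V \<otimes> V\<close> and let \<open>c\<close> be \<open>r\<close> followed by the flip. The axioms say that
  \<open>c \<circ> c = 1\<close>, that \<open>r\<close> satisfies the Yang-Baxter equation, and that the trace of \<open>c\<close> over the
  second factor, twisted by \<open>u\<close>, is the identity. The first two are
  equations in \<open>V \<otimes> V\<close> and \<open>V \<otimes> V \<otimes> V\<close>; they are stated by testing against all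
  multilinear forms.\<close>

locale vector_symmetry =
  fixes B :: "'v::complex_vector set" and K :: "'k set"
    and \<alpha> \<beta> :: "'k \<Rightarrow> 'v \<Rightarrow> 'v" and u :: "'v \<Rightarrow> 'v"
  assumes independent: "complex_vector.independent B"
    and span: "complex_vector.span B = UNIV"
    and finite_basis: "finite B"
    and finite_K: "finite K"
    and linear_\<alpha>: "clinear (\<alpha> k)"
    and linear_\<beta>: "clinear (\<beta> k)"
    and linear_u: "clinear u"
    and involutive: "cbilinear f \<Longrightarrow>
      (\<Sum>k\<in>K. \<Sum>l\<in>K. f (\<beta> l (\<alpha> k v)) (\<alpha> l (\<beta> k w))) = (f v w :: complex)"
    and yang_baxter: "\<lbrakk>\<And>y z. clinear (\<lambda>x. g x y z); \<And>x z. clinear (\<lambda>y. g x y z); \<And>x y. clinear (\<lambda>z. g x y z)\<rbrakk> \<Longrightarrow>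
      (\<Sum>k\<in>K. \<Sum>l\<in>K. \<Sum>m\<in>K. g (\<beta> m (\<beta> l z)) (\<alpha> m (\<beta> k y)) (\<alpha> l (\<alpha> k x))) =
      (\<Sum>k\<in>K. \<Sum>l\<in>K. \<Sum>m\<in>K. g (\<beta> l (\<beta> k z)) (\<beta> m (\<alpha> k y)) (\<alpha> m (\<alpha> l x)) :: complex)"
    and partial_trace: "(\<Sum>k\<in>K. \<beta> k (u (\<alpha> k v))) = v"
begin

abbreviation coord :: "'v \<Rightarrow> 'v \<Rightarrow> complex"
  where "coord e v \<equiv> complex_vector.representation B v e"

lemma clinear_coord: "clinear (coord e)"
  by (simp add: clinear_iff complex_vector.representation_add[OF independent]
      complex_vector.representation_scale[OF independent] span)

lemma coord_expand: "clinear f \<Longrightarrow> f v = (\<Sum>e\<in>B. coord e v *\<^sub>C f e)"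
proof -
  assume f: "clinear f"
  have "f v = f (\<Sum>e\<in>B. coord e v *\<^sub>C e)"
    using representation_expand[OF independent span finite_basis, of v] by simp
  then show ?thesis using f clinear_sum[OF f, of "\<lambda>e. coord e v *\<^sub>C e" B] by (simp add: clinear_iff)
qed

lemma multilinear_eqI:
  assumes F: "multilinear n F" and H: "multilinear n H"
    and eq: "\<And>v. v \<in> {..<n} \<rightarrow>\<^sub>E B \<Longrightarrow> F v = H v"
  shows "F = H"
proof -
  \<comment> \<open>one argument at a time is freed from the basis\<close>
  have "F \<omega> = H \<omega>" if "k \<le> n" "\<And>i. k \<le> i \<Longrightarrow> i < n \<Longrightarrow> \<omega> i \<in> B" for k \<omega>
    using that
  proof (induction k arbitrary: \<omega>)
    case 0
    then have "F (restrict \<omega> {..<n}) = H (restrict \<omega> {..<n})" by (intro eq) auto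
    moreover have "F (restrict \<omega> {..<n}) = F \<omega>" "H (restrict \<omega> {..<n}) = H \<omega>"
      by (rule multilinear_cong[OF F], simp) (rule multilinear_cong[OF H], simp)
    ultimately show ?case by simp
  next
    case (Suc k)
    have eq': "F (\<omega>(k := e)) = H (\<omega>(k := e))" if "e \<in> B" for e
      using Suc that by (intro Suc.IH) auto
    have lin: "clinear (\<lambda>v. F (\<omega>(k := v)))" "clinear (\<lambda>v. H (\<omega>(k := v)))"
      using Suc.prems(1) multilinear_clinear[OF F] multilinear_clinear[OF H] by auto
    have "F (\<omega>(k := v)) = H (\<omega>(k := v))" for v
      by (subst coord_expand[OF lin(1)], subst coord_expand[OF lin(2)]) (simp add: eq')
    from this[of "\<omega> k"] show ?case by simp
  qed
  from this[of n] show ?thesis by auto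
qed

text \<open>The transpose of \<open>c\<close>, acting on the factors \<open>i\<close> and \<open>i + 1\<close>.\<close>

definition Q :: "nat \<Rightarrow> ((nat \<Rightarrow> 'v) \<Rightarrow> complex) \<Rightarrow> (nat \<Rightarrow> 'v) \<Rightarrow> complex"
  where "Q i F \<omega> = (\<Sum>k\<in>K. F (\<omega>(i := \<beta> k (\<omega> (Suc i)), Suc i := \<alpha> k (\<omega> i))))"

lemma multilinear_Q:
  assumes i: "Suc i < n" and F: "multilinear n F"
  shows "multilinear n (Q i F)"
  unfolding multilinear_def
proof safe
  fix j \<omega> assume j: "j < n"
  show "clinear (\<lambda>v. Q i F (\<omega>(j := v)))"
    unfolding Q_def
  proof (rule clinear_sum_fun)
    fix k
    consider "j = i" | "j = Suc i" | "j \<noteq> i" "j \<noteq> Suc i" by blast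
    then show "clinear (\<lambda>v. F ((\<omega>(j := v))(i := \<beta> k ((\<omega>(j := v)) (Suc i)), Suc i := \<alpha> k ((\<omega>(j := v)) i))))"
    proof cases
      case 1
      have "clinear (\<lambda>v. F ((\<omega>(i := \<beta> k (\<omega> (Suc i))))(Suc i := \<alpha> k v)))"
        using multilinear_clinear[OF F i] linear_\<alpha> by (rule clinear_compose)
      then show ?thesis using 1 by (simp add: fun_upd_twist)
    next
      case 2
      have "clinear (\<lambda>v. F ((\<omega>(Suc i := \<alpha> k (\<omega> i)))(i := \<beta> k v)))"
        using i by (intro clinear_compose[OF multilinear_clinear[OF F] linear_\<beta>]) simp
      moreover have "(\<omega>(j := v))(i := \<beta> k v, Suc i := \<alpha> k (\<omega> i)) = (\<omega>(Suc i := \<alpha> k (\<omega> i)))(i := \<beta> k v)" for v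
        using 2 by auto
      ultimately show ?thesis using 2 by simp
    next
      case 3
      have "clinear (\<lambda>v. F ((\<omega>(i := \<beta> k (\<omega> (Suc i)), Suc i := \<alpha> k (\<omega> i)))(j := v)))"
        using j by (rule multilinear_clinear[OF F])
      moreover have "(\<omega>(j := v))(i := \<beta> k (\<omega> (Suc i)), Suc i := \<alpha> k (\<omega> i)) =
          (\<omega>(i := \<beta> k (\<omega> (Suc i)), Suc i := \<alpha> k (\<omega> i)))(j := v)" for v
        using 3 by auto
      ultimately show ?thesis using 3 by simp
    qed
  qed
next
  fix \<omega> \<omega>' :: "nat \<Rightarrow> 'v" assume "\<forall>i<n. \<omega> i = \<omega>' i"
  then show "Q i F \<omega> = Q i F \<omega>'"
    using i unfolding Q_def by (intro sum.cong refl multilinear_cong[OF F]) auto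
qed

lemma Q_involution:
  assumes i: "Suc i < n" and F: "multilinear n F"
  shows "Q i (Q i F) = F"
proof
  fix \<omega>
  define f where "f v w = F (\<omega>(i := v, Suc i := w))" for v w
  have "cbilinear f"
    using i multilinear_clinear[OF F] unfolding cbilinear_def f_def
    by (subst (2) fun_upd_twist) auto
  then have "(\<Sum>k\<in>K. \<Sum>l\<in>K. f (\<beta> l (\<alpha> k (\<omega> i))) (\<alpha> l (\<beta> k (\<omega> (Suc i))))) = f (\<omega> i) (\<omega> (Suc i))"
    by (rule involutive)
  moreover have "\<omega>(i := a, Suc i := b, i := v, Suc i := w) = \<omega>(i := v, Suc i := w)" for a b v w
    by auto
  ultimately show "Q i (Q i F) \<omega> = F \<omega>"
    by (simp add: Q_def f_def)
qed

lemma Q_braid: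
  assumes i: "Suc (Suc i) < n" and F: "multilinear n F"
  shows "Q i (Q (Suc i) (Q i F)) = Q (Suc i) (Q i (Q (Suc i) F))"
proof
  fix \<omega>
  define g where "g x y z = F (\<omega>(i := x, Suc i := y, Suc (Suc i) := z))" for x y z
  have upd: "\<omega>(i := x, Suc i := y, Suc (Suc i) := z) = \<omega>(Suc i := y, Suc (Suc i) := z, i := x)"
    "\<omega>(i := x, Suc i := y, Suc (Suc i) := z) = \<omega>(i := x, Suc (Suc i) := z, Suc i := y)" for x y z
    by auto
  have "clinear (\<lambda>x. g x y z)" for y z
    unfolding g_def upd(1) using i by (intro multilinear_clinear[OF F]) simp
  moreover have "clinear (\<lambda>y. g x y z)" for x z
    unfolding g_def upd(2) using i by (intro multilinear_clinear[OF F]) simp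
  moreover have "clinear (\<lambda>z. g x y z)" for x y
    unfolding g_def using i by (intro multilinear_clinear[OF F]) simp
  ultimately have yb: "(\<Sum>k\<in>K. \<Sum>l\<in>K. \<Sum>m\<in>K. g (\<beta> m (\<beta> l z)) (\<alpha> m (\<beta> k y)) (\<alpha> l (\<alpha> k x))) =
      (\<Sum>k\<in>K. \<Sum>l\<in>K. \<Sum>m\<in>K. g (\<beta> l (\<beta> k z)) (\<beta> m (\<alpha> k y)) (\<alpha> m (\<alpha> l x)))" for x y z
    by (rule yang_baxter)
  have "Q i (Q (Suc i) (Q i F)) \<omega> = (\<Sum>k\<in>K. \<Sum>l\<in>K. \<Sum>m\<in>K.
      g (\<beta> m (\<beta> l (\<omega> (Suc (Suc i))))) (\<alpha> m (\<beta> k (\<omega> (Suc i)))) (\<alpha> l (\<alpha> k (\<omega> i))))"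
    unfolding Q_def g_def
    by (intro sum.cong refl arg_cong[where f = F]) auto
  also have "\<dots> = (\<Sum>k\<in>K. \<Sum>l\<in>K. \<Sum>m\<in>K.
      g (\<beta> l (\<beta> k (\<omega> (Suc (Suc i))))) (\<beta> m (\<alpha> k (\<omega> (Suc i)))) (\<alpha> m (\<alpha> l (\<omega> i))))"
    by (rule yb)
  also have "\<dots> = Q (Suc i) (Q i (Q (Suc i) F)) \<omega>"
    unfolding Q_def g_def
    by (intro sum.cong refl arg_cong[where f = F]) auto
  finally show "Q i (Q (Suc i) (Q i F)) \<omega> = \<dots>" .
qed

lemma Q_commute:
  assumes "Suc i < j"
  shows "Q i (Q j F) = Q j (Q i F)"
proof
  fix \<omega>
  have "Q i (Q j F) \<omega> = (\<Sum>k\<in>K. \<Sum>l\<in>K. F (\<omega>(i := \<beta> k (\<omega> (Suc i)), Suc i := \<alpha> k (\<omega> i),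
      j := \<beta> l (\<omega> (Suc j)), Suc j := \<alpha> l (\<omega> j))))"
    using assms by (simp add: Q_def)
  also have "\<dots> = (\<Sum>l\<in>K. \<Sum>k\<in>K. F (\<omega>(j := \<beta> l (\<omega> (Suc j)), Suc j := \<alpha> l (\<omega> j),
      i := \<beta> k (\<omega> (Suc i)), Suc i := \<alpha> k (\<omega> i))))"
    using assms by (subst sum.swap) (intro sum.cong refl arg_cong[where f = F], auto)
  also have "\<dots> = Q j (Q i F) \<omega>"
    using assms by (simp add: Q_def)
  finally show "Q i (Q j F) \<omega> = \<dots>" .
qed

sublocale braided: coxeter_action n "Collect (multilinear n)" Q for n
  by unfold_locales (auto simp: multilinear_Q Q_involution Q_braid intro: Q_commute)

lemma foldr_Q_sum: "foldr Q w (\<lambda>\<omega>. \<Sum>a\<in>A. c a * G a \<omega>) \<omega> = (\<Sum>a\<in>A. c a * foldr Q w (G a) \<omega>)"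
proof (induction w arbitrary: \<omega>)
  case (Cons i w)
  then have "foldr Q w (\<lambda>\<omega>. \<Sum>a\<in>A. c a * G a \<omega>) = (\<lambda>\<omega>. \<Sum>a\<in>A. c a * foldr Q w (G a) \<omega>)"
    by blast
  then have "foldr Q (i # w) (\<lambda>\<omega>. \<Sum>a\<in>A. c a * G a \<omega>) = Q i (\<lambda>\<omega>. \<Sum>a\<in>A. c a * foldr Q w (G a) \<omega>)"
    by simp
  then show ?case
    unfolding Q_def by (simp add: sum_distrib_left) (subst sum.swap, simp add: Q_def sum_distrib_left)
qed simp

text \<open>The operator of the word \<open>w\<close> on forms in \<open>n + 1\<close> vectors, traced over the last factor with the
  twist \<open>u\<close>: the dual basis vector \<open>coord e\<close> is put into slot \<open>n\<close>, and afterwards slot \<open>n\<close> is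
  evaluated at \<open>u e\<close>.\<close>

definition partial_trace_word :: "nat \<Rightarrow> nat list \<Rightarrow> ((nat \<Rightarrow> 'v) \<Rightarrow> complex) \<Rightarrow> (nat \<Rightarrow> 'v) \<Rightarrow> complex"
  where "partial_trace_word n w F \<omega> =
    (\<Sum>e\<in>B. foldr Q w (\<lambda>\<omega>. coord e (\<omega> n) * F \<omega>) (\<omega>(n := u e)))"

definition quantum_trace :: complex
  where "quantum_trace = (\<Sum>e\<in>B. coord e (u e))"

text \<open>Operators on the first \<open>n\<close> factors can be taken out of the partial trace, on either side.\<close>

lemma partial_trace_right:
  assumes "w \<in> letters n"
  shows "partial_trace_word n (v @ w) F = partial_trace_word n v (foldr Q w F)"
proof -
  have *: "foldr Q w (\<lambda>\<omega>. coord e (\<omega> n) * F \<omega>) = (\<lambda>\<omega>. coord e (\<omega> n) * foldr Q w F \<omega>)" for e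
    using assms
  proof (induction w)
    case (Cons i w)
    then show ?case by (simp add: Q_def fun_eq_iff sum_distrib_left)
  qed simp
  show ?thesis by (rule ext) (simp only: partial_trace_word_def foldr_append comp_apply *)
qed

lemma partial_trace_left:
  assumes "w \<in> letters n"
  shows "partial_trace_word n (w @ v) F = foldr Q w (partial_trace_word n v F)"
  using assms
proof (induction w)
  case (Cons i w)
  show ?case
  proof
    fix \<omega> :: "nat \<Rightarrow> 'v"
    have upd: "\<omega>(n := e, i := x, Suc i := y) = \<omega>(i := x, Suc i := y, n := e)" for e x y :: 'v and \<omega>
      using Cons.prems by auto
    have "partial_trace_word n ((i # w) @ v) F \<omega> = Q i (partial_trace_word n (w @ v) F) \<omega>"
      using Cons.prems unfolding partial_trace_word_def Q_def
      by (simp add: Q_def upd) (rule sum.swap)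
    then show "partial_trace_word n ((i # w) @ v) F \<omega> = foldr Q (i # w) (partial_trace_word n v F) \<omega>"
      using Cons by simp
  qed
qed simp

lemma partial_trace_Nil:
  assumes "multilinear n F"
  shows "partial_trace_word n [] F = (\<lambda>\<omega>. quantum_trace * F \<omega>)"
proof -
  have "F (\<omega>(n := v)) = F \<omega>" for \<omega> v
    by (rule multilinear_cong[OF assms]) simp
  then show ?thesis
    by (simp add: partial_trace_word_def quantum_trace_def sum_distrib_right fun_eq_iff)
qed

text \<open>The sum over the basis contracts to \<open>\<Sum> \<beta> k (u (\<alpha> k v))\<close> in slot \<open>n - 1\<close>, where \<open>v\<close> is the
  vector in that slot; the sum is \<open>v\<close> again.\<close>

lemma partial_trace_letter:
  assumes n: "0 < n" and F: "multilinear n F"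
  shows "partial_trace_word n [n - 1] F = F"
proof
  fix \<omega>
  obtain m where m: "n = Suc m" using n by (cases n) auto
  have lin: "clinear (\<lambda>x. F (\<omega>(m := x)))" using m by (intro multilinear_clinear[OF F]) simp
  have indep: "F (\<omega>'(n := v)) = F \<omega>'" for \<omega>' v
    by (rule multilinear_cong[OF F]) simp
  have lin_k: "clinear (\<lambda>v. F (\<omega>(m := \<beta> k (u v))))" for k
    by (rule clinear_compose[OF lin clinear_compose[OF linear_\<beta> linear_u]])
  have "partial_trace_word n [n - 1] F \<omega> =
      (\<Sum>k\<in>K. \<Sum>e\<in>B. coord e (\<alpha> k (\<omega> m)) * F (\<omega>(m := \<beta> k (u e))))"
    unfolding partial_trace_word_def
    by (subst sum.swap) (simp add: Q_def m indep[unfolded m] fun_upd_twist)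
  also have "\<dots> = (\<Sum>k\<in>K. F (\<omega>(m := \<beta> k (u (\<alpha> k (\<omega> m))))))"
    by (intro sum.cong refl) (subst coord_expand[OF lin_k], simp)
  also have "\<dots> = F (\<omega>(m := (\<Sum>k\<in>K. \<beta> k (u (\<alpha> k (\<omega> m))))))"
    by (rule clinear_sum[OF lin, symmetric])
  also have "\<dots> = F \<omega>"
    by (simp add: partial_trace)
  finally show "partial_trace_word n [n - 1] F \<omega> = F \<omega>" .
qed


definition word :: "nat \<Rightarrow> (nat \<Rightarrow> nat) \<Rightarrow> nat list"
  where "word n p = (SOME w. w \<in> letters n \<and> apply_adj_transps w = p)"

lemma word:
  assumes "p permutes {..<n}"
  shows "word n p \<in> letters n" "apply_adj_transps (word n p) = p"
  using someI_ex[of "\<lambda>w. w \<in> letters n \<and> apply_adj_transps w = p"] exists_word[OF assms]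
  unfolding word_def by blast+

lemma multilinear_coord_times:
  assumes F: "multilinear n F"
  shows "multilinear (Suc n) (\<lambda>\<omega>. coord e (\<omega> n) * F \<omega>)"
  unfolding multilinear_def
proof safe
  fix i \<omega> assume i: "i < Suc n"
  have indep: "F (\<omega>(n := v)) = F \<omega>" for v
    by (rule multilinear_cong[OF F]) simp
  show "clinear (\<lambda>v. coord e ((\<omega>(i := v)) n) * F (\<omega>(i := v)))"
  proof (cases "i = n")
    case True
    then show ?thesis using clinear_coord[of e] indep by (simp add: clinear_iff algebra_simps)
  next
    case False
    then show ?thesis using multilinear_clinear[OF F, of i \<omega>] i by (simp add: clinear_iff algebra_simps)
  qed
next
  fix \<omega> \<omega>' :: "nat \<Rightarrow> 'v" assume "\<forall>i<Suc n. \<omega> i = \<omega>' i"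
  then show "coord e (\<omega> n) * F \<omega> = coord e (\<omega>' n) * F \<omega>'"
    using multilinear_cong[OF F, of \<omega> \<omega>'] by simp
qed

lemma partial_trace_same_permutation:
  assumes "v \<in> letters (Suc n)" "w \<in> letters (Suc n)" "apply_adj_transps v = apply_adj_transps w"
    "multilinear n F"
  shows "partial_trace_word n v F = partial_trace_word n w F"
  unfolding partial_trace_word_def
  using braided.act_eq_if_same_permutation[OF assms(1-3)] multilinear_coord_times[OF assms(4)]
  by (simp add: fun_eq_iff)

text \<open>Together with the next lemma this is the Markov property: the partial trace of a permutation that
  fixes \<open>n\<close> only contributes the factor \<open>quantum_trace\<close>, and otherwise the point \<open>n\<close> is deleted from its
  cycle.\<close>

lemma partial_trace_fixing:
  assumes q: "q permutes {..<n}" and F: "multilinear n F"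
  shows "partial_trace_word n (word (Suc n) q) F = (\<lambda>\<omega>. quantum_trace * foldr Q (word n q) F \<omega>)"
proof -
  have q': "q permutes {..<Suc n}" by (rule permutes_subset[OF q]) auto
  have "partial_trace_word n (word (Suc n) q) F = partial_trace_word n ([] @ word n q) F"
    using word[OF q] word[OF q'] F by (intro partial_trace_same_permutation) (auto intro: letters_mono)
  also have "\<dots> = partial_trace_word n [] (foldr Q (word n q) F)"
    using word[OF q] by (intro partial_trace_right)
  also have "\<dots> = (\<lambda>\<omega>. quantum_trace * foldr Q (word n q) F \<omega>)"
    using braided.act_closed[of "word n q" n F] word[OF q] F by (intro partial_trace_Nil) simp
  finally show ?thesis .
qed

text \<open>The transposition \<open>(n i)\<close> is conjugate to \<open>(n-1 n)\<close> by a word \<open>c\<close> in the smaller symmetric group;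
  \<open>c\<close> and its inverse leave the partial trace on both sides and cancel once the middle letter
  has been traced out.\<close>

lemma partial_trace_moving:
  assumes q: "q permutes {..<n}" and i: "i < n" and F: "multilinear n F"
  shows "partial_trace_word n (word (Suc n) (transpose n i \<circ> q)) F = foldr Q (word n q) F"
proof -
  let ?c = "[i..<n - 1]"
  have tq: "transpose n i \<circ> q permutes {..<Suc n}"
    using i by (intro permutes_compose permutes_subset[OF q] permutes_swap_id) auto
  have c: "?c \<in> letters n" using i by (intro letters_upt) simp
  have F': "foldr Q (word n q) F \<in> Collect (multilinear n)"
    using word[OF q] F by (intro braided.act_closed) auto
  then have F'': "multilinear n (foldr Q (rev ?c) (foldr Q (word n q) F))"
    using braided.act_closed[of "rev ?c" n] c by simp
  have "apply_adj_transps (?c @ [n - 1] @ rev ?c @ word n q) = transpose n i \<circ> q"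
    using apply_adj_transps_conj[OF i] word[OF q]
    by (simp add: apply_adj_transps_append transpose_commute flip: comp_assoc)
  then have "partial_trace_word n (word (Suc n) (transpose n i \<circ> q)) F =
      partial_trace_word n (?c @ [n - 1] @ rev ?c @ word n q) F"
    using word[OF q] word[OF tq] c i F
    by (intro partial_trace_same_permutation) (auto intro: letters_mono)
  also have "\<dots> = foldr Q ?c (partial_trace_word n ([n - 1] @ rev ?c @ word n q) F)"
    by (rule partial_trace_left[OF c])
  also have "partial_trace_word n ([n - 1] @ rev ?c @ word n q) F =
      partial_trace_word n [n - 1] (foldr Q (rev ?c @ word n q) F)"
    using c word[OF q] by (intro partial_trace_right) simp
  also have "\<dots> = foldr Q (rev ?c) (foldr Q (word n q) F)"
    using i partial_trace_letter[OF _ F''] by simp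
  also have "foldr Q ?c \<dots> = foldr Q (word n q) F"
    by (rule braided.act_rev[OF c F'])
  finally show ?thesis .
qed

text \<open>If an element \<open>x\<close> of the group algebra of the symmetric group on \<open>{..n}\<close> acts by zero, then so do
  its products with the transpositions \<open>(n j)\<close>, and so do the partial traces of these products. By
  the Markov property these are elements of the smaller group algebra with the coefficients
  \<open>d x((n j) q) + \<Sum>i<n. x((n j) (n i) q)\<close> at \<open>q\<close>, where \<open>d\<close> is the quantum trace, so by induction
  all of them vanish. As \<open>q\<close> fixes \<open>n\<close>, the product \<open>(n q(i)) q\<close> equals \<open>q (i n)\<close>, and thus these
  coefficients are those of \<open>x (J + d)\<close> for the Jucys-Murphy element \<open>J\<close>. If \<open>d\<close> is not an integer,
  then \<open>-d\<close> is not an eigenvalue of \<open>J\<close> and \<open>x\<close> is zero.\<close>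

lemma permutations_independent:
  assumes d: "quantum_trace \<notin> \<int>"
    and zero: "\<And>F \<omega>. multilinear n F \<Longrightarrow>
      (\<Sum>p | p permutes {..<n}. x p * foldr Q (word n p) F \<omega>) = 0"
    and p: "p permutes {..<n}"
  shows "x p = 0"
  using zero p
proof (induction n arbitrary: x p)
  case 0
  have "multilinear 0 (\<lambda>_. 1)" by (simp add: multilinear_def)
  from "0.prems"(1)[OF this] have "x id * foldr Q (word 0 id) (\<lambda>_. 1) undefined = 0"
    by (simp add: id_def)
  moreover have "word 0 id = []"
    using word(1)[of id 0] by (cases "word 0 id") auto
  ultimately show ?case using "0.prems"(2) by (simp add: id_def)
next
  case (Suc n)
  let ?S = "{p. p permutes {..<n}}" and ?S' = "{p. p permutes {..<Suc n}}"
  have relation: "quantum_trace * x (transpose n j \<circ> q) + (\<Sum>i<n. x (transpose n j \<circ> (transpose n i \<circ> q))) = 0"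
    if j: "j < Suc n" and q: "q permutes {..<n}" for j q
  proof -
    let ?t = "transpose n j"
    have t: "?t permutes {..<Suc n}" using j by (intro permutes_swap_id) auto
    have "(\<Sum>q\<in>?S. (quantum_trace * x (?t \<circ> q) + (\<Sum>i<n. x (?t \<circ> (transpose n i \<circ> q))))
        * foldr Q (word n q) F \<omega>) = 0" if F: "multilinear n F" for F \<omega>
    proof -
      let ?G = "\<lambda>e \<omega>. coord e (\<omega> n) * F \<omega>"
      have word_t: "foldr Q (word (Suc n) (?t \<circ> p)) (?G e) = foldr Q (word (Suc n) ?t @ word (Suc n) p) (?G e)"
        if "p permutes {..<Suc n}" for e p
        using word[OF t] word[OF that] word[OF permutes_compose[OF that t]] multilinear_coord_times[OF F]
        by (intro braided.act_eq_if_same_permutation[of _ "Suc n"]) (auto simp: apply_adj_transps_append)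
      have "(\<Sum>p\<in>?S'. x p * foldr Q (word (Suc n) (?t \<circ> p)) (?G e) \<omega>') = 0" for e \<omega>'
      proof -
        have "(\<Sum>p\<in>?S'. x p * foldr Q (word (Suc n) (?t \<circ> p)) (?G e) \<omega>') =
            (\<Sum>p\<in>?S'. x p * foldr Q (word (Suc n) ?t) (foldr Q (word (Suc n) p) (?G e)) \<omega>')"
          using word_t by (intro sum.cong) auto
        also have "\<dots> = foldr Q (word (Suc n) ?t) (\<lambda>\<omega>. \<Sum>p\<in>?S'. x p * foldr Q (word (Suc n) p) (?G e) \<omega>) \<omega>'"
          by (rule foldr_Q_sum[symmetric])
        also have "\<dots> = foldr Q (word (Suc n) ?t) (\<lambda>\<omega>. \<Sum>p\<in>{}. x p * foldr Q (word (Suc n) p) (?G e) \<omega>) \<omega>'"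
          using Suc.prems(1)[OF multilinear_coord_times[OF F]] by simp
        also have "\<dots> = 0" by (subst foldr_Q_sum) simp
        finally show ?thesis .
      qed
      then have "0 = (\<Sum>e\<in>B. \<Sum>p\<in>?S'. x p * foldr Q (word (Suc n) (?t \<circ> p)) (?G e) (\<omega>(n := u e)))"
        by simp
      also have "\<dots> = (\<Sum>p\<in>?S'. x p * partial_trace_word n (word (Suc n) (?t \<circ> p)) F \<omega>)"
        by (subst sum.swap) (simp add: partial_trace_word_def sum_distrib_left)
      also have "\<dots> = (\<Sum>p\<in>?S'. x (?t \<circ> p) * partial_trace_word n (word (Suc n) p) F \<omega>)"
        by (rule sum.reindex_bij_witness[of _ "\<lambda>p. ?t \<circ> p" "\<lambda>p. ?t \<circ> p"])
          (auto simp: t permutes_compose simp flip: comp_assoc)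
      also have "\<dots> = (\<Sum>b\<in>insert n {..<n}. \<Sum>q\<in>?S.
          x (?t \<circ> (transpose n b \<circ> q)) * partial_trace_word n (word (Suc n) (transpose n b \<circ> q)) F \<omega>)"
        unfolding lessThan_Suc by (rule sum_over_permutations_insert) auto
      also have "\<dots> = (\<Sum>q\<in>?S. x (?t \<circ> q) * (quantum_trace * foldr Q (word n q) F \<omega>))
          + (\<Sum>b<n. \<Sum>q\<in>?S. x (?t \<circ> (transpose n b \<circ> q)) * foldr Q (word n q) F \<omega>)"
        by (simp add: partial_trace_fixing partial_trace_moving F)
      also have "\<dots> = (\<Sum>q\<in>?S. (quantum_trace * x (?t \<circ> q) + (\<Sum>i<n. x (?t \<circ> (transpose n i \<circ> q))))
          * foldr Q (word n q) F \<omega>)"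
        by (subst sum.swap) (simp add: distrib_right sum.distrib sum_distrib_right mult.assoc mult.left_commute)
      finally show ?thesis by simp
    qed
    from Suc.IH[of "\<lambda>q. quantum_trace * x (?t \<circ> q) + (\<Sum>i<n. x (?t \<circ> (transpose n i \<circ> q)))", OF this q]
    show ?thesis .
  qed
  have eigen: "jucys_murphy n x p = - quantum_trace * x p" if p: "p permutes {..<Suc n}" for p
  proof -
    obtain j q where jq: "p = transpose n j \<circ> q" "j < Suc n" "q permutes {..<n}"
      using p permutes_insert[of n "{..<n}"] unfolding lessThan_Suc by fastforce
    have "q n = n" using permutes_not_in[OF jq(3)] by simp
    then have conj: "q \<circ> transpose i n = transpose n (q i) \<circ> q" for i
      using transpose_comp_eq[OF permutes_bij[OF jq(3)], of n "q i"] permutes_inj[OF jq(3)]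
      by (metis inv_f_eq transpose_commute)
    have "jucys_murphy n x p = (\<Sum>i<n. x (transpose n j \<circ> (transpose n (q i) \<circ> q)))"
      by (simp add: jucys_murphy_def jq(1) comp_assoc conj)
    also have "\<dots> = (\<Sum>i<n. x (transpose n j \<circ> (transpose n i \<circ> q)))"
      by (subst (2) sum.permute[OF jq(3)]) simp
    also have "\<dots> = - quantum_trace * x p"
      using relation[OF jq(2,3)] jq(1) by (simp add: add_eq_0_iff)
    finally show ?thesis .
  qed
  \<comment> \<open>\<open>x\<close> is arbitrary outside the group; the eigenvector equation needs the extension by zero\<close>
  define y where "y = (\<lambda>p. if p permutes {..<Suc n} then x p else 0)"
  have "(p \<circ> transpose i n) permutes {..<Suc n} \<longleftrightarrow> p permutes {..<Suc n}" if "i < n" for i p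
  proof -
    have t: "transpose i n permutes {..<Suc n}" using that by (intro permutes_swap_id) auto
    have "p = (p \<circ> transpose i n) \<circ> transpose i n" by (simp add: comp_assoc)
    then show ?thesis using permutes_compose[OF t] by metis
  qed
  then have "jucys_murphy n y p = - quantum_trace * y p" for p
    using eigen[of p] by (simp add: jucys_murphy_def y_def)
  then have "y p = 0"
    using d by (intro jucys_murphy_eigenvalue_integer[of "- quantum_trace" n y]) (auto simp: minus_in_Ints_iff)
  then show ?case using Suc.prems(2) by (simp add: y_def)
qed


text \<open>Were the quantum trace not an integer, the \<open>n!\<close> operators of the permutations would be linearly
  independent on a space of dimension \<open>N ^ n\<close> with \<open>N = card B\<close>, so that \<open>n! \<le> N ^ (2 * n)\<close>
  for all \<open>n\<close>. This fails for large \<open>n\<close>.\<close>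

theorem quantum_trace_integer: "quantum_trace \<in> \<int>"
proof (rule ccontr)
  assume d: "quantum_trace \<notin> \<int>"
  have "(\<lambda>n. inverse (fact n) * real (card B ^ 2) ^ n) \<longlonglongrightarrow> 0"
    by (rule summable_LIMSEQ_zero[OF summable_exp])
  then have "\<forall>\<^sub>F n in sequentially. inverse (fact n) * real (card B ^ 2) ^ n < 1"
    by (rule order_tendstoD) simp
  then obtain n where "inverse (fact n) * real (card B ^ 2) ^ n < 1"
    using eventually_happens'[OF sequentially_bot] by blast
  then have "real (card B ^ 2) ^ n < real (fact n)"
    by (simp add: inverse_eq_divide divide_less_eq)
  then have "(card B ^ 2) ^ n < fact n"
    by (metis of_nat_less_iff of_nat_power)
  then have n: "card B ^ n * card B ^ n < fact n"
    by (simp add: power2_eq_square power_mult_distrib)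
  let ?S = "{p. p permutes {..<n}}"
  let ?W = "{..<n} \<rightarrow>\<^sub>E B"
  \<comment> \<open>the tensor products of dual basis vectors, a basis of the forms in \<open>n\<close> vectors\<close>
  define G where "G v \<omega> = (\<Prod>i<n. coord (v i) (\<omega> i))" for v \<omega>
  have G: "multilinear n (G v)" for v
    unfolding multilinear_def
  proof safe
    fix i \<omega> assume i: "i < n"
    have "G v (\<omega>(i := z)) = coord (v i) z * (\<Prod>j\<in>{..<n} - {i}. coord (v j) (\<omega> j))" for z
      using i unfolding G_def by (subst prod.remove[of _ i]) auto
    then show "clinear (\<lambda>z. G v (\<omega>(i := z)))"
      using clinear_coord[of "v i"] by (simp add: clinear_iff algebra_simps)
  qed (simp add: G_def)
  have G_eq: "G v w = (if v = w then 1 else 0)" if "v \<in> ?W" "w \<in> ?W" for v w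
  proof -
    have c: "coord (v i) (w i) = (if w i = v i then 1 else 0)" if "i < n" for i
    proof -
      have "w i \<in> B" using \<open>w \<in> ?W\<close> that by auto
      from complex_vector.representation_basis[OF independent this] show ?thesis by auto
    qed
    show ?thesis
    proof (cases "v = w")
      case True
      then show ?thesis using c by (simp add: G_def)
    next
      case False
      then obtain i where "i < n" "v i \<noteq> w i" using \<open>v \<in> ?W\<close> \<open>w \<in> ?W\<close> PiE_ext by (metis lessThan_iff)
      then show ?thesis using c False by (auto simp: G_def intro!: prod_zero)
    qed
  qed
  have finite_W: "finite ?W" by (rule finite_PiE) (auto simp: finite_basis)
  have card: "card (?W \<times> ?W) < card ?S"
    using n by (simp add: card_cartesian_product card_PiE card_permutations[OF refl])
  \<comment> \<open>one equation for each of the \<open>N ^ (2 * n)\<close> matrix entries\<close>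
  obtain x where x: "\<exists>p\<in>?S. x p \<noteq> 0"
    "\<forall>(v, w)\<in>?W \<times> ?W. (\<Sum>p\<in>?S. x p * foldr Q (word n p) (G v) w) = 0"
    using underdetermined_system[OF _ _ card, where M = "\<lambda>p (v, w). foldr Q (word n p) (G v) w"]
      finite_W finite_permutations[of "{..<n}"] by (auto simp: split_beta)
  have "(\<Sum>p\<in>?S. x p * foldr Q (word n p) F \<omega>) = 0" if F: "multilinear n F" for F \<omega>
  proof -
    have F_eq: "F = (\<lambda>\<omega>. \<Sum>v\<in>?W. F v * G v \<omega>)"
    proof (rule multilinear_eqI[OF F multilinear_sum[OF G]])
      fix w assume w: "w \<in> ?W"
      then have "(\<Sum>v\<in>?W. F v * G v w) = (\<Sum>v\<in>?W. if v = w then F v else 0)"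
        by (intro sum.cong) (auto simp: G_eq)
      then show "F w = (\<Sum>v\<in>?W. F v * G v w)" using w finite_W by simp
    qed
    have "(\<lambda>\<omega>. \<Sum>p\<in>?S. x p * foldr Q (word n p) (G v) \<omega>) = (\<lambda>_. 0)" if "v \<in> ?W" for v
    proof (rule multilinear_eqI)
      show "multilinear n (\<lambda>\<omega>. \<Sum>p\<in>?S. x p * foldr Q (word n p) (G v) \<omega>)"
        using braided.act_closed[of _ n "G v"] word(1) G by (intro multilinear_sum) auto
      show "multilinear n (\<lambda>_. 0)" by (simp add: multilinear_def clinear_iff)
    qed (use x(2) that in auto)
    then have Gv: "(\<Sum>p\<in>?S. x p * foldr Q (word n p) (G v) \<omega>) = 0" if "v \<in> ?W" for v
      using that by meson
    have "(\<Sum>p\<in>?S. x p * foldr Q (word n p) F \<omega>) =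
        (\<Sum>p\<in>?S. x p * (\<Sum>v\<in>?W. F v * foldr Q (word n p) (G v) \<omega>))"
      by (subst F_eq) (simp only: foldr_Q_sum)
    also have "\<dots> = (\<Sum>v\<in>?W. F v * (\<Sum>p\<in>?S. x p * foldr Q (word n p) (G v) \<omega>))"
      by (simp add: sum_distrib_left) (subst sum.swap, simp add: mult.left_commute)
    also have "\<dots> = 0" using Gv by simp
    finally show ?thesis .
  qed
  then have "x p = 0" if "p \<in> ?S" for p
    using permutations_independent[OF d] that by blast
  then show False using x(1) by blast
qed

end


section \<open>The vector symmetry of a representation\<close>

lemma tensor_lift_sum: "cbilinear f \<Longrightarrow> tensor_lift f (\<Sum>k\<in>K. t k) = (\<Sum>k\<in>K. tensor_lift f (t k))"
  by (rule clinear_sum[OF clinear_tensor_lift])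

lemma tensor_as_sum_of_pure:
  fixes t :: "('a::complex_vector, 'b::complex_vector) tensor"
  obtains K :: "('a \<times> 'b) set" and a b where "finite K" "t = (\<Sum>k\<in>K. a k \<otimes>\<^sub>t b k)"
proof
  have "tensor_lift (\<otimes>\<^sub>t) t = t"
    by (induction t) (simp_all add: cbilinear_pure_tensor tensor_lift_add)
  then show "t = (\<Sum>k\<in>Poly_Mapping.keys (rep_tensor t).
      (Poly_Mapping.lookup (rep_tensor t) k *\<^sub>C fst k) \<otimes>\<^sub>t snd k)"
    by (simp add: tensor_lift_def free_eval_def pure_tensor_simps)
qed simp

text \<open>Linear extension of a trilinear map to the triple tensor product. It turns identities in
  \<open>H \<otimes> (H \<otimes> H)\<close> into identities of sums over \<open>K\<close>.\<close>

definition tensor_lift3 ::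
  "('a::complex_vector \<Rightarrow> 'b::complex_vector \<Rightarrow> 'c::complex_vector \<Rightarrow> 'd::complex_vector)
    \<Rightarrow> ('a, ('b, 'c) tensor) tensor \<Rightarrow> 'd"
  where "tensor_lift3 g = tensor_lift (\<lambda>x. tensor_lift (g x))"

context
  fixes g :: "'a::complex_vector \<Rightarrow> 'b::complex_vector \<Rightarrow> 'c::complex_vector \<Rightarrow> 'd::complex_vector"
  assumes g: "\<And>y z. clinear (\<lambda>x. g x y z)" "\<And>x z. clinear (\<lambda>y. g x y z)" "\<And>x y. clinear (\<lambda>z. g x y z)"
begin

lemma cbilinear_inner: "cbilinear (g x)"
  using g by (simp add: cbilinear_def)

lemma cbilinear_outer: "cbilinear (\<lambda>x. tensor_lift (g x))"
proof -
  have "g (x + x') = (\<lambda>y z. g x y z + g x' y z)" "g (c *\<^sub>C x) = (\<lambda>y z. c *\<^sub>C g x y z)" for x x' c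
    using g(1) by (simp_all add: clinear_iff fun_eq_iff)
  then show ?thesis
    unfolding cbilinear_iff
    by (simp add: tensor_lift_add tensor_lift_scale cbilinear_inner
        tensor_lift_fun_add tensor_lift_fun_scale)
qed

lemma tensor_lift3_left: "tensor_lift3 g (x \<otimes>\<^sub>t t) = tensor_lift (g x) t"
  by (simp add: tensor_lift3_def cbilinear_outer)

lemma tensor_lift3_pure: "tensor_lift3 g (x \<otimes>\<^sub>t (y \<otimes>\<^sub>t z)) = g x y z"
  by (simp add: tensor_lift3_left cbilinear_inner)

lemma tensor_lift3_sum: "tensor_lift3 g (\<Sum>k\<in>K. t k) = (\<Sum>k\<in>K. tensor_lift3 g (t k))"
  by (simp add: tensor_lift3_def tensor_lift_sum cbilinear_outer)

end

lemma tensor_lift_compose: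
  assumes "cbilinear f" "clinear h"
  shows "h (tensor_lift f t) = tensor_lift (\<lambda>x y. h (f x y)) t"
proof -
  have hf: "cbilinear (\<lambda>x y. h (f x y))"
    using assms by (simp add: cbilinear_iff clinear_iff)
  show ?thesis
    by (induction t) (use assms in \<open>simp_all add: hf tensor_lift_add clinear_zero clinear_iff\<close>)
qed

text \<open>A fixed expansion \<open>R = \<Sum> a k \<otimes> b k\<close>, so that all computations with \<open>R\<close> become manipulations
  of finite sums.\<close>

locale triangular_hopf_algebra_expansion = triangular_hopf_algebra \<Delta> \<epsilon> S R
  for \<Delta> :: "'h::complex_algebra_1 \<Rightarrow> ('h, 'h) tensor" and \<epsilon> S R +
  fixes K :: "'k set" and a b :: "'k \<Rightarrow> 'h"
  assumes finite_K: "finite K" and R_eq: "R = (\<Sum>k\<in>K. a k \<otimes>\<^sub>t b k)"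
begin

lemma flip_R_times_R:
  "(\<Sum>k\<in>K. \<Sum>l\<in>K. (b l * a k) \<otimes>\<^sub>t (a l * b k)) = 1 \<otimes>\<^sub>t 1"
proof -
  have "tensor_flip R * R = (\<Sum>l\<in>K. \<Sum>k\<in>K. (b l * a k) \<otimes>\<^sub>t (a l * b k))"
    by (simp add: R_eq clinear_sum[OF clinear_tensor_flip] sum_product)
  then show ?thesis
    using R21_R by (subst sum.swap) (simp add: one_tensor_def)
qed

lemma map_comult_R: "tensor_map id \<Delta> R = (\<Sum>k\<in>K. a k \<otimes>\<^sub>t \<Delta> (b k))"
proof -
  have id: "clinear (id :: 'h \<Rightarrow> 'h)" by (simp add: clinear_iff)
  show ?thesis
    by (simp add: R_eq clinear_sum[OF clinear_tensor_map[OF id clinear_comult]] id clinear_comult)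
qed

lemma comult_right_R:
  "(\<Sum>k\<in>K. a k \<otimes>\<^sub>t \<Delta> (b k)) = (\<Sum>l\<in>K. \<Sum>k\<in>K. (a l * a k) \<otimes>\<^sub>t (b k \<otimes>\<^sub>t b l))"
proof -
  have "cbilinear (\<lambda>(x :: 'h) (y :: 'h). x \<otimes>\<^sub>t (y \<otimes>\<^sub>t (1::'h)))"
    "cbilinear (\<lambda>(x :: 'h) (y :: 'h). x \<otimes>\<^sub>t ((1::'h) \<otimes>\<^sub>t y))"
    by (auto simp: cbilinear_iff pure_tensor_simps)
  then have "leg12 R = (\<Sum>k\<in>K. a k \<otimes>\<^sub>t (b k \<otimes>\<^sub>t 1))" "leg13 R = (\<Sum>l\<in>K. a l \<otimes>\<^sub>t (1 \<otimes>\<^sub>t b l))"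
    by (simp_all add: leg12_def leg13_def R_eq tensor_lift_sum)
  then have "leg13 R * leg12 R = (\<Sum>l\<in>K. \<Sum>k\<in>K. (a l * a k) \<otimes>\<^sub>t (b k \<otimes>\<^sub>t b l))"
    by (simp add: sum_product)
  then show ?thesis using hexagon_right map_comult_R by simp
qed

text \<open>\<open>R\<close> intertwines the coproduct with the opposite one. Applied to the second leg of \<open>R\<close> this reads
  \<open>R\<^sub>2\<^sub>3 (id \<otimes> \<Delta>)(R) = (id \<otimes> \<Delta>\<^sup>o\<^sup>p)(R) R\<^sub>2\<^sub>3\<close>, and by the hexagon the two sides are
  \<open>R\<^sub>2\<^sub>3 R\<^sub>1\<^sub>3 R\<^sub>1\<^sub>2\<close> and \<open>R\<^sub>1\<^sub>2 R\<^sub>1\<^sub>3 R\<^sub>2\<^sub>3\<close>.\<close>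

lemma R_yang_baxter:
  "(\<Sum>k\<in>K. \<Sum>l\<in>K. \<Sum>m\<in>K. (a l * a k) \<otimes>\<^sub>t ((a m * b k) \<otimes>\<^sub>t (b m * b l))) =
   (\<Sum>k\<in>K. \<Sum>l\<in>K. \<Sum>m\<in>K. (a m * a l) \<otimes>\<^sub>t ((b m * a k) \<otimes>\<^sub>t (b l * b k)))"
proof -
  let ?R = "1 \<otimes>\<^sub>t R :: ('h, ('h, 'h) tensor) tensor"
  let ?D = "\<Sum>k\<in>K. a k \<otimes>\<^sub>t \<Delta> (b k)" and ?D' = "\<Sum>k\<in>K. a k \<otimes>\<^sub>t tensor_flip (\<Delta> (b k))"
  obtain R' where R': "R' * R = 1" "\<And>x. tensor_flip (\<Delta> x) = R * \<Delta> x * R'"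
    using R_conj by blast
  have "R * \<Delta> x = tensor_flip (\<Delta> x) * R" for x
    by (simp add: R'(2) mult.assoc R'(1))
  then have eq: "?R * ?D = ?D' * ?R"
    by (simp add: sum_distrib_left sum_distrib_right)
  have id: "clinear (id :: 'h \<Rightarrow> 'h)" by (simp add: clinear_iff)
  note flip = clinear_tensor_map[OF id clinear_tensor_flip]
  have R_sum: "?R = (\<Sum>m\<in>K. 1 \<otimes>\<^sub>t (a m \<otimes>\<^sub>t b m))"
    by (simp add: R_eq pure_tensor_sum_right)
  have "?D' = tensor_map id tensor_flip ?D"
    by (simp add: clinear_sum[OF flip] id clinear_tensor_flip)
  also have "\<dots> = (\<Sum>l\<in>K. \<Sum>k\<in>K. (a l * a k) \<otimes>\<^sub>t (b l \<otimes>\<^sub>t b k))"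
    by (simp add: comult_right_R clinear_sum[OF flip] id clinear_tensor_flip)
  finally have D': "?D' = \<dots>" .
  have "?R * ?D = (\<Sum>l\<in>K. \<Sum>k\<in>K. \<Sum>m\<in>K. (a l * a k) \<otimes>\<^sub>t ((a m * b k) \<otimes>\<^sub>t (b m * b l)))"
    by (simp add: comult_right_R) (simp add: R_sum sum_distrib_left sum_distrib_right)
  moreover have "?D' * ?R = (\<Sum>k\<in>K. \<Sum>m\<in>K. \<Sum>l\<in>K. (a m * a l) \<otimes>\<^sub>t ((b m * a k) \<otimes>\<^sub>t (b l * b k)))"
    by (simp add: D') (simp add: R_sum sum_distrib_left sum_distrib_right)
  moreover have "\<dots> = (\<Sum>k\<in>K. \<Sum>l\<in>K. \<Sum>m\<in>K. (a m * a l) \<otimes>\<^sub>t ((b m * a k) \<otimes>\<^sub>t (b l * b k)))"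
    by (intro sum.cong refl sum.swap)
  ultimately show ?thesis
    using eq by (subst sum.swap) simp
qed

text \<open>Write \<open>e\<close> for the left-hand side. The counit applied to the middle leg of the hexagon gives
  \<open>R = R (e \<otimes> 1)\<close>, and \<open>R\<close> is invertible.\<close>

lemma counit_right_R: "(\<Sum>k\<in>K. \<epsilon> (b k) *\<^sub>C a k) = 1"
proof -
  let ?e = "\<Sum>k\<in>K. \<epsilon> (b k) *\<^sub>C a k"
  define g where "g x y z = (\<epsilon> y *\<^sub>C x) \<otimes>\<^sub>t z" for x y z :: 'h
  have g: "clinear (\<lambda>x. g x y z)" "clinear (\<lambda>y. g x y z)" "clinear (\<lambda>z. g x y z)" for x y z
    using clinear_counit by (auto simp: g_def clinear_iff pure_tensor_simps scaleC_add_left scaleC_add_right mult.commute)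
  have bil: "cbilinear (\<lambda>y z :: 'h. \<epsilon> y *\<^sub>C z)"
    using clinear_counit by (auto simp: cbilinear_iff clinear_iff scaleC_add_left scaleC_add_right mult.commute)
  have pure: "clinear (\<lambda>z. x \<otimes>\<^sub>t z)" for x :: 'h
    by (simp add: clinear_iff pure_tensor_simps)
  have g_eq: "g x = (\<lambda>y z. x \<otimes>\<^sub>t (\<epsilon> y *\<^sub>C z))" for x
    by (simp add: g_def fun_eq_iff pure_tensor_simps)
  have "tensor_lift (g x) t = x \<otimes>\<^sub>t tensor_lift (\<lambda>y z. \<epsilon> y *\<^sub>C z) t" for x t
    using tensor_lift_compose[OF bil pure[of x], of t] by (simp add: g_eq)
  then have "tensor_lift3 g (\<Sum>k\<in>K. a k \<otimes>\<^sub>t \<Delta> (b k)) = R"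
    by (simp add: tensor_lift3_sum[OF g] tensor_lift3_left[OF g] counit_left R_eq)
  moreover have "tensor_lift3 g (\<Sum>k\<in>K. a k \<otimes>\<^sub>t \<Delta> (b k)) = R * (?e \<otimes>\<^sub>t 1)"
    by (simp add: comult_right_R tensor_lift3_sum[OF g] tensor_lift3_pure[OF g])
      (simp add: g_def R_eq sum_product pure_tensor_sum_left)
  ultimately have "R * (?e \<otimes>\<^sub>t 1) = R" by simp
  moreover obtain R' where "R' * R = 1" using R_conj by blast
  ultimately have "?e \<otimes>\<^sub>t 1 = (1 \<otimes>\<^sub>t 1 :: ('h, 'h) tensor)"
    by (metis mult.assoc mult_1_left one_tensor_def)
  moreover have "cbilinear (\<lambda>(x :: 'h) (y :: 'h). \<epsilon> y *\<^sub>C x)"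
    using clinear_counit by (auto simp: cbilinear_iff clinear_iff scaleC_add_left scaleC_add_right mult.commute)
  ultimately show ?thesis
    by (metis (no_types, lifting) tensor_lift_pure counit_one scaleC_one)
qed

text \<open>The Drinfeld element of \<open>(H, R)\<close>.\<close>

definition drinfeld :: 'h where "drinfeld = (\<Sum>l\<in>K. S (b l) * a l)"

text \<open>The map \<open>x \<otimes> (y \<otimes> z) \<mapsto> y S(z) x\<close> sends one side of the hexagon to the left-hand side. On the other
  side the antipode axiom collapses \<open>\<Delta> (b k)\<close>, and \<open>\<Sum> \<epsilon> (b k) a k = 1\<close> remains.\<close>

lemma drinfeld_conj: "(\<Sum>k\<in>K. b k * drinfeld * a k) = 1"
proof -
  define g where "g x y z = y * S z * x" for x y z :: 'h
  have g: "clinear (\<lambda>x. g x y z)" "clinear (\<lambda>y. g x y z)" "clinear (\<lambda>z. g x y z)" for x y z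
    using clinear_antipode by (auto simp: g_def clinear_iff algebra_simps)
  have bil: "cbilinear (\<lambda>y z. y * S z)"
    using clinear_antipode by (auto simp: cbilinear_iff clinear_iff algebra_simps)
  have times: "clinear (\<lambda>z. z * x)" for x :: 'h
    by (simp add: clinear_iff algebra_simps)
  have "tensor_lift (g x) t = tensor_lift (\<lambda>y z. y * S z) t * x" for x t
    using tensor_lift_compose[OF bil times[of x], of t] by (simp add: g_def[abs_def])
  then have "tensor_lift3 g (\<Sum>k\<in>K. a k \<otimes>\<^sub>t \<Delta> (b k)) = 1"
    by (simp add: tensor_lift3_sum[OF g] tensor_lift3_left[OF g] antipode_right counit_right_R)
  moreover have "tensor_lift3 g (\<Sum>k\<in>K. a k \<otimes>\<^sub>t \<Delta> (b k)) = (\<Sum>l\<in>K. \<Sum>k\<in>K. b k * S (b l) * (a l * a k))"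
    by (simp add: comult_right_R tensor_lift3_sum[OF g] tensor_lift3_pure[OF g]) (simp add: g_def)
  ultimately show ?thesis
    by (subst (asm) sum.swap) (simp add: drinfeld_def sum_distrib_left sum_distrib_right mult.assoc)
qed

text \<open>The three axioms are the images under \<open>\<rho>\<close> of \<open>R\<^sub>2\<^sub>1 R = 1\<close>, of the Yang-Baxter equation and of the
  identity for the Drinfeld element.\<close>

lemma vector_symmetry_representation:
  fixes \<rho> :: "'h \<Rightarrow> 'v::complex_vector \<Rightarrow> 'v"
  assumes \<rho>: "algebra_representation \<rho>"
    and B: "complex_vector.independent B" "complex_vector.span B = UNIV" "finite B"
  shows "vector_symmetry B K (\<lambda>k. \<rho> (a k)) (\<lambda>k. \<rho> (b k)) (\<rho> drinfeld)"
proof -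
  interpret algebra_representation \<rho> by (rule \<rho>)
  have lin: "clinear (\<rho> x)" "clinear (\<lambda>x. \<rho> x v)" for x v
    using cbilinear_rep by (auto simp: cbilinear_def)
  show ?thesis
  proof
    fix f :: "'v \<Rightarrow> 'v \<Rightarrow> complex" and v w :: 'v
    assume f: "cbilinear f"
    then have bil: "cbilinear (\<lambda>x y. f (\<rho> x v) (\<rho> y w))"
      using lin by (simp add: cbilinear_iff clinear_iff)
    have "tensor_lift (\<lambda>x y. f (\<rho> x v) (\<rho> y w)) (1 \<otimes>\<^sub>t 1) = f v w"
      by (simp add: bil rep_one)
    then show "(\<Sum>k\<in>K. \<Sum>l\<in>K. f (\<rho> (b l) (\<rho> (a k) v)) (\<rho> (a l) (\<rho> (b k) w))) = f v w"
      by (simp flip: flip_R_times_R) (simp add: tensor_lift_sum bil rep_mult)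
  next
    fix g :: "'v \<Rightarrow> 'v \<Rightarrow> 'v \<Rightarrow> complex" and x y z :: 'v
    assume g: "\<And>y z. clinear (\<lambda>x. g x y z)" "\<And>x z. clinear (\<lambda>y. g x y z)" "\<And>x y. clinear (\<lambda>z. g x y z)"
    define h where "h p q r = g (\<rho> r z) (\<rho> q y) (\<rho> p x)" for p q r
    have h: "clinear (\<lambda>p. h p q r)" "clinear (\<lambda>q. h p q r)" "clinear (\<lambda>r. h p q r)" for p q r
      unfolding h_def using g[THEN clinear_compose, OF lin(2)] by blast+
    show "(\<Sum>k\<in>K. \<Sum>l\<in>K. \<Sum>m\<in>K. g (\<rho> (b m) (\<rho> (b l) z)) (\<rho> (a m) (\<rho> (b k) y)) (\<rho> (a l) (\<rho> (a k) x))) =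
        (\<Sum>k\<in>K. \<Sum>l\<in>K. \<Sum>m\<in>K. g (\<rho> (b l) (\<rho> (b k) z)) (\<rho> (b m) (\<rho> (a k) y)) (\<rho> (a m) (\<rho> (a l) x)))"
      using arg_cong[OF R_yang_baxter, of "tensor_lift3 h"]
      by (simp add: tensor_lift3_sum[OF h] tensor_lift3_pure[OF h]) (simp add: h_def rep_mult)
  next
    fix v
    show "(\<Sum>k\<in>K. \<rho> (b k) (\<rho> drinfeld (\<rho> (a k) v))) = v"
      using clinear_sum[OF lin(2), of "\<lambda>k. b k * drinfeld * a k" K v]
      by (simp add: drinfeld_conj rep_mult rep_one)
  qed (use B lin finite_K in \<open>auto simp: clinear_iff\<close>)
qed

text \<open>Coevaluation produces \<open>\<Sum> e \<otimes> e\<^sup>*\<close>, and evaluating after \<open>R\<close> and the flip yields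
  \<open>\<Sum> e\<^sup>* (S(b k) a k e)\<close>, since \<open>b k\<close> acts on \<open>e\<^sup>*\<close> through the antipode.\<close>

lemma categorical_dim_eq_trace:
  fixes \<rho> :: "'h \<Rightarrow> 'v::complex_vector \<Rightarrow> 'v"
  assumes \<rho>: "algebra_representation \<rho>"
    and B: "complex_vector.independent B" "complex_vector.span B = UNIV" "finite B"
  shows "categorical_dim S R \<rho> = (\<Sum>e\<in>B. complex_vector.representation B (\<rho> drinfeld e) e)"
proof -
  interpret algebra_representation \<rho> by (rule \<rho>)
  have lin: "clinear (\<rho> x)" "clinear (\<lambda>x. \<rho> x v)" for x v
    using cbilinear_rep by (auto simp: cbilinear_def)
  let ?\<sigma> = "dual_rep S \<rho>"
  have dual_rep_apply: "dual_apply (?\<sigma> h f) v = dual_apply f (\<rho> (S h) v)" for h f v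
    unfolding dual_rep_def using lin(1)[of "S h"]
    by (subst Abs_dual_inverse) (auto simp: clinear_iff dual_apply_simps)
  have \<sigma>: "clinear (?\<sigma> h)" "clinear (\<lambda>h. ?\<sigma> h f)" for h f
    using lin(2) clinear_antipode
    by (auto simp: clinear_iff dual_apply_inject[symmetric] fun_eq_iff dual_rep_apply dual_apply_simps)
  have act: "cbilinear (\<lambda>x y. tensor_map (\<rho> x) (?\<sigma> y) t)" for t
    using lin \<sigma>
    by (simp add: cbilinear_iff clinear_iff tensor_map_def pure_tensor_simps
        tensor_lift_fun_add tensor_lift_fun_scale)
  have ev: "clinear (ev :: ('v dual, 'v) tensor \<Rightarrow> complex)"
    unfolding ev_def by (rule clinear_tensor_lift[OF cbilinear_dual_apply])
  have "categorical_dim S R \<rho> = ev (tensor_flip (\<Sum>k\<in>K. tensor_map (\<rho> (a k)) (?\<sigma> (b k)) (\<Sum>e\<in>B. e \<otimes>\<^sub>t coordinate B e)))"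
    by (simp add: categorical_dim_def braiding_def tensor_act_def coev_basis[OF B] R_eq tensor_lift_sum act)
  also have "\<dots> = (\<Sum>k\<in>K. \<Sum>e\<in>B. complex_vector.representation B (\<rho> (S (b k)) (\<rho> (a k) e)) e)"
    by (simp add: clinear_sum[OF ev] clinear_sum[OF clinear_tensor_flip] lin \<sigma>
        clinear_sum[OF clinear_tensor_map[OF lin(1) \<sigma>(1)]] dual_rep_apply dual_apply_coordinate[OF B(1,2)])
  also have "\<dots> = (\<Sum>e\<in>B. complex_vector.representation B (\<rho> drinfeld e) e)"
  proof -
    have rep: "clinear (\<lambda>x. complex_vector.representation B (\<rho> x e) e)" for e
      using lin(2) by (simp add: clinear_iff complex_vector.representation_add[OF B(1)]
          complex_vector.representation_scale[OF B(1)] B(2))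
    show ?thesis
      by (subst sum.swap) (simp add: drinfeld_def clinear_sum[OF rep] rep_mult)
  qed
  finally show ?thesis .
qed

end

theorem corollary7p3:
  fixes \<Delta> :: "'h::complex_algebra_1 \<Rightarrow> ('h, 'h) tensor"
    and \<epsilon> :: "'h \<Rightarrow> complex"
    and S :: "'h \<Rightarrow> 'h"
    and R :: "('h, 'h) tensor"
    and \<rho> :: "'h \<Rightarrow> 'v::complex_vector \<Rightarrow> 'v"
  assumes "triangular_hopf_algebra \<Delta> \<epsilon> S R"
    and "finite_dimensional_representation \<rho>"
  shows "categorical_dim S R \<rho> \<in> \<int>"
proof -
  interpret finite_dimensional_representation \<rho> by (rule assms(2))
  obtain K :: "('h \<times> 'h) set" and a b where K: "finite K" "R = (\<Sum>k\<in>K. a k \<otimes>\<^sub>t b k)"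
    by (rule tensor_as_sum_of_pure)
  interpret triangular_hopf_algebra_expansion \<Delta> \<epsilon> S R K a b
    using assms(1) K by (simp add: triangular_hopf_algebra_expansion_def triangular_hopf_algebra_expansion_axioms_def)
  obtain B where "finite_dimensional_vector_space (scaleC :: complex \<Rightarrow> 'v \<Rightarrow> 'v) B"
    using finite_dimensional by blast
  then have B: "complex_vector.independent B" "complex_vector.span B = UNIV" "finite B"
    by (simp_all add: finite_dimensional_vector_space_def finite_dimensional_vector_space_axioms_def)
  interpret vector_symmetry B K "\<lambda>k. \<rho> (a k)" "\<lambda>k. \<rho> (b k)" "\<rho> drinfeld"
    by (rule vector_symmetry_representation[OF algebra_representation_axioms B])
  show ?thesis
    using quantum_trace_integer
    by (simp add: categorical_dim_eq_trace[OF algebra_representation_axioms B] quantum_trace_def)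
qed

end
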